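(* Let $A_0,A_1,\ldots,A_n$ be independent and identically distributed $\mathrm{N}(0,1)$ random variables. Consider the random linear homogeneous difference equation of order $n$, $A_nx_{k+n}+A_{n-1}x_{k+n-1}+\cdots+A_1x_{k+1}+A_0x_k=0$, let $X$ be the number of roots with modulus smaller than $1$, counted with multiplicity, of its characteristic polynomial $Q(\lambda)=A_n\lambda^n+A_{n-1}\lambda^{n-1}+\cdots+A_1\lambda+A_0$, and set $p_i=P(X=i)$ for $i=0,1,\ldots,n$. (i) $E(X)=\sum_{i=0}^n i\,p_i=\frac n2$. Moreover: (a) If $n$ is odd, then $2\sum_{i=0}^{(n-1)/2}p_i=1$. In particular, when $n=1$, $p_0=p_1=\frac12$. (b) If $n$ is even and $n\ge2$, then $2\sum_{i=0}^{n/2-1}p_i+p_{n/2}=1$. If, additionally, $n$ is even and $\sum_{i\text{ odd}}p_i=\sum_{i\text{ even}}p_i=\frac12$, then: (c) If $\frac n2$ is even, then $2\sum_{0\le i\le n/2-2,\ i\text{ even}}p_i+p_{n/2}=\frac12$ and $2\sum_{1\le i\le n/2-1,\ i\text{ odd}}p_i=\frac12$. In particular, when $n=4$, $p_1=p_3=\frac14$, $p_2=\frac12-2p_0$ and $p_4=p_0$. (d) If $\frac n2$ is odd, then $2\sum_{0\le i\le n/2-1,\ i\text{ even}}p_i=\frac12$ and $2\sum_{1\le i\le n/2-2,\ i\text{ odd}}p_i+p_{n/2}=\frac12$. In particular, when $n=2$, $p_0=p_2=\frac14$ and $p_1=\frac12$. (ii) Moreover, if $n=2m$ is even, then $$\sum_{i\text{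 even}}p_i=\frac2\pi\arctan\left(\sqrt{\frac{m+1}{m}}\right)\quad\text{and}\quad\sum_{i\text{ odd}}p_i=\frac2\pi\arctan\left(\sqrt{\frac{m}{m+1}}\right).$$ In particular, for $n=2$, $p_0=p_2=\frac1\pi\arctan(\sqrt2)$ and $p_1=\frac2\pi\arctan\left(\frac1{\sqrt2}\right)$; and for $n=4$, $p_1=p_3=\frac1\pi\arctan\left(\sqrt{\frac23}\right)$.
   Context: Sums over $i$ even (respectively odd) with no stated range are over the even (respectively odd) elements of $\{0,1,\ldots,n\}$; empty sums are zero. Since $A_n\neq0$ almost surely, $Q$ has degree $n$ almost surely. Items (c) and (d) of part (i) are conditional on the additional hypothesis stated immediately before them. *)

theory Defs
  imports "HOL-Probability.Probability" "HOL-Computational_Algebra.Computational_Algebra"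
begin

text \<open>The characteristic polynomial of the difference equation
  \<open>a n * x (k + n) + \<dots> + a 1 * x (k + 1) + a 0 * x k = 0\<close>, taken over the complex numbers
  so that all its roots are available.\<close>

definition difference_char_poly :: "nat \<Rightarrow> (nat \<Rightarrow> real) \<Rightarrow> complex poly" where
  "difference_char_poly n a = (\<Sum>i\<le>n. monom (complex_of_real (a i)) i)"

text \<open>Roots are counted with multiplicity. Since \<^term>\<open>proots 0\<close> is empty, the zero
  polynomial gets the value 0.\<close>

definition num_roots_unit_disc :: "complex poly \<Rightarrow> nat" where
  "num_roots_unit_disc q = size (filter_mset (\<lambda>z. cmod z < 1) (proots q))"

end

theory Submission
  imports Defs
begin

text \<open>The law of the coefficients is invariant under reversing their order, which replaces the
  characteristic polynomial by its reflection and hence every root \<open>z\<close> by \<open>1/z\<close>. Almost surely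
  there is no root on the unit circle, so \<open>X\<close> and \<open>n - X\<close> have the same law; this gives part (i).
  For part (ii), the parity of \<open>X\<close> is the sign of \<open>Q(1) Q(-1) = U\<^sup>2 - V\<^sup>2\<close>, where \<open>U\<close> and \<open>V\<close> are
  the sums of the even and of the odd coefficients. These are independent centred normal variables
  with variances \<open>m + 1\<close> and \<open>m\<close>, so \<open>P(|U| < |V|)\<close> is an arctangent.\<close>

section \<open>Roots in the unit disc\<close>

text \<open>Normality is used only for the arctangent. The symmetry of \<open>X\<close> rests on
  independence and a common density, the density serving to discard three null events:
  \<open>A 0 \<omega> = 0\<close>, \<open>A n \<omega> = 0\<close>, and a root on the circle.
  Reflection forces this: it loses roots at 0, needs a non-zero leading coefficient to be reversal
  at order \<open>n\<close>, and exchanges inside and outside exactly only when no root has modulus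
  1. Roots at 1 or -1 would also destroy the sign of Q(1) Q(-1).

  The obstacle is measurability. Equality of laws says nothing about \<open>X\<close> until
  \<open>X\<close> is a measurable function of the coefficients, and the roots come as an unordered
  multiset with no chosen measurable enumeration. So roots are never selected: "at least
  \<open>k\<close> roots in \<open>S\<close>" is read as the existence of a factorization, and the
  set of coefficient vectors admitting one is handled by compactness.\<close>

lemma coeff_difference_char_poly:
  "coeff (difference_char_poly n a) i = (if i \<le> n then complex_of_real (a i) else 0)"
  by (auto simp: difference_char_poly_def coeff_sum sum.delta' intro!: sum.neutral)

lemma degree_difference_char_poly_le: "degree (difference_char_poly n a) \<le> n"
  by (rule degree_le) (simp add: coeff_difference_char_poly)

lemma poly_difference_char_poly:
  "poly (difference_char_poly n a) z = (\<Sum>i\<le>n. complex_of_real (a i) * z ^ i)"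
  by (simp add: difference_char_poly_def poly_sum poly_monom)

lemma num_roots_unit_disc_mult:
  "p \<noteq> 0 \<Longrightarrow> q \<noteq> 0 \<Longrightarrow>
    num_roots_unit_disc (p * q) = num_roots_unit_disc p + num_roots_unit_disc q"
  by (simp add: num_roots_unit_disc_def proots_mult)

lemma num_roots_unit_disc_linear:
  "num_roots_unit_disc [:- z, 1:] = (if cmod z < 1 then 1 else 0)"
  by (simp add: num_roots_unit_disc_def)

lemma num_roots_unit_disc_le: "num_roots_unit_disc q \<le> degree q"
  unfolding num_roots_unit_disc_def
  by (metis size_proots_complex size_filter_mset_lesseq)

lemma map_poly_cnj_mult: "map_poly cnj (p * q) = map_poly cnj p * map_poly cnj q"
  by (intro poly_eqI) (simp add: coeff_map_poly coeff_mult)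

lemma poly_map_poly_cnj: "poly (map_poly cnj p) (cnj z) = cnj (poly p z)"
  by (induction p) (simp_all add: map_poly_pCons)

text \<open>Invariance under \<open>map_poly cnj\<close> encodes real coefficients. Conjugation is
  multiplicative, so a real factor can be cancelled; this keeps the cofactor real in the induction
  on the degree below.\<close>

lemma map_poly_cnj_cancel:
  fixes p q :: "complex poly"
  assumes "map_poly cnj (p * q) = p * q" "map_poly cnj p = p" "p \<noteq> 0"
  shows "map_poly cnj q = q"
  using assms by (simp add: map_poly_cnj_mult)

text \<open>Over the reals a polynomial splits into linear factors, whose contribution to
  \<open>P(1) P(-1)\<close> is \<open>r\<^sup>2 - 1\<close>, and quadratic factors without real roots, whose contribution is
  positive and whose two roots have the same modulus.\<close>

lemma parity_num_roots_unit_disc: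
  fixes P :: "complex poly"
  assumes "map_poly cnj P = P" "poly P 1 \<noteq> 0" "poly P (-1) \<noteq> 0"
  shows "\<exists>c::real. c > 0 \<and> poly P 1 * poly P (-1) = of_real ((-1) ^ num_roots_unit_disc P * c)"
  using assms
proof (induction "degree P" arbitrary: P rule: less_induct)
  case less
  have P0: "P \<noteq> 0" using less.prems by auto
  show ?case
  proof (cases "degree P = 0")
    case True
    then obtain a where a: "P = [:a:]" by (meson degree_eq_zeroE)
    have "a \<in> \<real>" using less.prems(1) by (auto simp: a Reals_cnj_iff map_poly_pCons split: if_splits)
    then obtain r where r: "a = of_real r" by (auto elim: Reals_cases)
    have "r \<noteq> 0" using less.prems a r by auto
    then show ?thesis
      by (intro exI[of _ "r * r"]) (simp add: a r num_roots_unit_disc_def flip: power2_eq_square)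
  next
    case False
    then obtain z where z: "poly P z = 0" using alg_closed_imp_poly_has_root by blast
    \<comment> \<open>The factor to split off is made real, so that the cofactor satisfies the
      induction hypothesis: a nonreal root takes its conjugate along, which differs from it and
      hence is still a root after division by the first linear factor.\<close>
    define D where "D = (if z \<in> \<real> then [:-z, 1:] else [:-z, 1:] * [:- cnj z, 1:])"
    have Dcnj: "map_poly cnj D = D"
      unfolding D_def by (auto simp: map_poly_cnj_mult map_poly_pCons Reals_cnj_iff mult.commute)
    have D0: "D \<noteq> 0" by (auto simp: D_def)
    have degD: "degree D > 0" by (auto simp: D_def degree_mult_eq)
    have "D dvd P"
    proof (cases "z \<in> \<real>")
      case True
      then show ?thesis using z by (simp add: D_def poly_eq_0_iff_dvd)
    next
      case False
      have "[:-z, 1:] dvd P" using z by (simp add: poly_eq_0_iff_dvd)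
      then obtain Q where Q: "P = [:-z, 1:] * Q" by (elim dvdE)
      have "poly P (cnj z) = 0" using poly_map_poly_cnj[of P z] z less.prems(1) by simp
      moreover have "cnj z \<noteq> z" using False by (simp add: Reals_cnj_iff)
      ultimately have "poly Q (cnj z) = 0" by (simp add: Q)
      then have "[:- cnj z, 1:] dvd Q" by (simp add: poly_eq_0_iff_dvd)
      then show ?thesis using False by (simp add: D_def Q del: mult_pCons_left mult_pCons_right)
    qed
    then obtain Q where Q: "P = D * Q" by (elim dvdE)
    have Q0: "Q \<noteq> 0" using P0 Q by auto
    have "degree Q < degree P" using degD by (simp add: Q degree_mult_eq D0 Q0)
    moreover have "map_poly cnj Q = Q"
      using less.prems(1) Dcnj D0 unfolding Q by (rule map_poly_cnj_cancel)
    ultimately obtain c where c: "c > 0"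
        "poly Q 1 * poly Q (-1) = of_real ((-1) ^ num_roots_unit_disc Q * c)"
      using less.hyps[of Q] less.prems by (auto simp: Q)
    have "\<exists>c::real. c > 0 \<and> poly D 1 * poly D (-1) = of_real ((-1) ^ num_roots_unit_disc D * c)"
    proof (cases "z \<in> \<real>")
      case True
      then obtain r where r: "z = of_real r" by (auto elim: Reals_cases)
      have "poly D 1 \<noteq> 0" "poly D (-1) \<noteq> 0" using less.prems by (auto simp: Q)
      \<comment> \<open>Since 1 and -1 are not roots, \<open>r\<^sup>2 - 1\<close> is non-zero and
        its sign tells whether \<open>r\<close> lies inside the disc.\<close>
      then have r1: "\<bar>r\<bar> \<noteq> 1" using True by (auto simp: D_def r abs_if split: if_splits)
      have e: "poly D 1 * poly D (-1) = of_real (r\<^sup>2 - 1)"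
        using True by (simp add: D_def r algebra_simps power2_eq_square)
      show ?thesis
      proof (cases "\<bar>r\<bar> < 1")
        case t: True
        have "r\<^sup>2 < 1" using t by (simp add: abs_square_less_1)
        moreover have "num_roots_unit_disc D = 1" using True t
          by (simp add: D_def num_roots_unit_disc_linear r)
        ultimately show ?thesis unfolding e by (intro exI[of _ "1 - r\<^sup>2"]) simp
      next
        case f: False
        have "r\<^sup>2 > 1" using f r1 by (metis abs_square_le_1 abs_square_eq_1 linorder_not_le
            less_eq_real_def)
        moreover have "num_roots_unit_disc D = 0" using True f
          by (simp add: D_def num_roots_unit_disc_linear r)
        ultimately show ?thesis unfolding e by (intro exI[of _ "r\<^sup>2 - 1"]) simp
      qed
    next
      case False
      have "num_roots_unit_disc D = (if cmod z < 1 then 2 else 0)"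
        using False unfolding D_def
        by (simp add: num_roots_unit_disc_mult num_roots_unit_disc_linear
            del: mult_pCons_left mult_pCons_right)
      then have s: "(-1::real) ^ num_roots_unit_disc D = 1" by simp
      have "poly D 1 = (1 - z) * cnj (1 - z)" "poly D (-1) = (1 + z) * cnj (1 + z)"
        using False by (simp_all add: D_def algebra_simps)
      then have "poly D 1 * poly D (-1) = of_real ((cmod (1 - z))\<^sup>2 * (cmod (1 + z))\<^sup>2)"
        by (simp only: complex_norm_square of_real_mult)
      moreover have "z \<noteq> 1" "z \<noteq> -1" using False by auto
      then have "(cmod (1 - z))\<^sup>2 * (cmod (1 + z))\<^sup>2 > 0"
        by (metis add_cancel_left_right add_eq_0_iff diff_self eq_iff_diff_eq_0 mult_pos_pos
            minus_minus zero_less_norm_iff zero_less_power)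
      ultimately show ?thesis unfolding s by (metis mult_1)
    qed
    then obtain d where d: "d > 0"
        "poly D 1 * poly D (-1) = of_real ((-1) ^ num_roots_unit_disc D * d)" by blast
    have "poly P 1 * poly P (-1) = (poly D 1 * poly D (-1)) * (poly Q 1 * poly Q (-1))"
      by (simp add: Q)
    also have "\<dots> = of_real ((-1) ^ num_roots_unit_disc P * (d * c))"
      unfolding c d by (simp add: Q num_roots_unit_disc_mult D0 Q0 power_add)
    finally show ?thesis using c d by (intro exI[of _ "d * c"]) simp
  qed
qed

section \<open>Reversed coefficients and inverted roots\<close>

text \<open>Reflection is multiplicative and turns X - x into -x (X - 1/x), so it suffices to treat
  linear factors. A non-zero constant coefficient keeps 0 out of the roots; a root at 0 would
  disappear under reflection.\<close>

lemma proots_reflect_poly: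
  fixes p :: "complex poly"
  assumes "coeff p 0 \<noteq> 0"
  shows "proots (reflect_poly p) = image_mset inverse (proots p)"
proof -
  have prod: "proots (reflect_poly (\<Prod>x\<in>#R. [:-x, 1:])) = image_mset inverse R"
    if "0 \<notin># R" for R :: "complex multiset"
    using that
  proof (induction R)
    case (add x R)
    then have x: "x \<noteq> 0" by auto
    have "reflect_poly [:-x, 1:] = smult (-x) [:- inverse x, 1:]"
      using x by (simp add: reflect_poly_pCons)
    moreover have "proots (smult (-x) [:- inverse x, 1:]) = {#inverse x#}"
      using x by (subst proots_smult) auto
    ultimately have "proots (reflect_poly [:-x, 1:]) = {#inverse x#}"
      by (simp only:)
    moreover have "reflect_poly (\<Prod>x\<in>#R. [:-x, 1:]) \<noteq> 0"
      by (auto simp: prod_mset_zero_iff)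
    ultimately show ?case using add by (simp add: reflect_poly_mult proots_mult
          del: mult_pCons_left mult_pCons_right)
  qed simp
  have "p \<noteq> 0" using assms by auto
  then have "0 \<notin># proots p" using assms by (simp add: poly_0_coeff_0)
  then have "proots (reflect_poly (\<Prod>x\<in>#proots p. [:-x, 1:])) = image_mset inverse (proots p)"
    by (rule prod)
  moreover have "proots (reflect_poly p) = proots (reflect_poly (\<Prod>x\<in>#proots p. [:-x, 1:]))"
    using \<open>p \<noteq> 0\<close> by (subst (1) complex_poly_decompose_multiset[symmetric])
      (simp add: reflect_poly_smult)
  ultimately show ?thesis by simp
qed

text \<open>Inversion exchanges the inside and the outside of the circle. With no root on the
  circle, the roots moved inside are exactly those not counted before.\<close>

lemma num_roots_unit_disc_reflect_poly:
  assumes "coeff p 0 \<noteq> 0" "\<And>z. cmod z = 1 \<Longrightarrow> poly p z \<noteq> 0"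
  shows "num_roots_unit_disc (reflect_poly p) = degree p - num_roots_unit_disc p"
proof -
  have p: "p \<noteq> 0" using assms(1) by auto
  have "filter_mset (\<lambda>z. cmod (inverse z) < 1) (proots p) = filter_mset (\<lambda>z. \<not> cmod z < 1) (proots p)"
  proof (rule filter_mset_cong[OF refl])
    fix z assume "z \<in># proots p"
    then have "poly p z = 0" using p by simp
    then have "z \<noteq> 0" "cmod z \<noteq> 1" using assms by (auto simp: poly_0_coeff_0)
    then show "cmod (inverse z) < 1 \<longleftrightarrow> \<not> cmod z < 1"
      by (auto simp: norm_inverse inverse_less_1_iff)
  qed
  moreover have "size (proots p) = size (filter_mset (\<lambda>z. cmod z < 1) (proots p))
      + size (filter_mset (\<lambda>z. \<not> cmod z < 1) (proots p))"
    by (metis multiset_partition size_union)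
  ultimately show ?thesis
    by (simp add: num_roots_unit_disc_def proots_reflect_poly[OF assms(1)] filter_mset_image_mset
        size_proots_complex o_def)
qed

lemma degree_difference_char_poly: "a n \<noteq> 0 \<Longrightarrow> degree (difference_char_poly n a) = n"
  by (intro antisym degree_difference_char_poly_le le_degree) (simp add: coeff_difference_char_poly)

lemma difference_char_poly_rev:
  "a n \<noteq> 0 \<Longrightarrow> difference_char_poly n (\<lambda>i. a (n - i)) = reflect_poly (difference_char_poly n a)"
  by (intro poly_eqI)
    (simp add: coeff_reflect_poly degree_difference_char_poly coeff_difference_char_poly)

lemma map_poly_cnj_difference_char_poly:
  "map_poly cnj (difference_char_poly n a) = difference_char_poly n a"
  by (intro poly_eqI) (simp add: coeff_map_poly coeff_difference_char_poly)

text \<open>A point \<open>z\<close> of the unit circle with \<open>R(z)\<close> real satisfies \<open>R(z) = R(1/z)\<close>; clearing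
  denominators gives a polynomial equation of degree \<open>2 deg R\<close>.\<close>

lemma finite_constant_terms_with_circle_root:
  fixes R :: "complex poly"
  assumes R: "map_poly cnj R = R" "coeff R 0 = 0" "R \<noteq> 0"
  shows "finite {x::real. \<exists>z. cmod z = 1 \<and> poly R z + of_real x = 0}"
proof -
  define d where "d = degree R"
  have "d > 0" using R unfolding d_def by (metis bot_nat_0.not_eq_extremum leading_coeff_0_iff)
  define T where "T = monom 1 d * R - reflect_poly R"
  \<comment> \<open>The reflection has degree at most \<open>d\<close>, which is below
    \<open>d + d\<close> because a non-zero polynomial without constant term has positive degree. So
    only z^d R(z) reaches this coefficient and \<open>T\<close> cannot vanish.\<close>
  have "coeff T (d + d) = lead_coeff R"
    using \<open>d > 0\<close> degree_reflect_poly_le[of R]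
    by (simp add: T_def coeff_monom_mult d_def coeff_eq_0)
  then have "T \<noteq> 0" using R by auto
  then have "finite {z. poly T z = 0}" by (rule poly_roots_finite)
  then have "finite ((\<lambda>z. - Re (poly R z)) ` {z. poly T z = 0})" by simp
  moreover have "{x::real. \<exists>z. cmod z = 1 \<and> poly R z + of_real x = 0} \<subseteq>
      (\<lambda>z. - Re (poly R z)) ` {z. poly T z = 0}"
  proof safe
    fix x z assume z: "cmod z = 1" "poly R z + complex_of_real x = 0"
    have "poly R z = of_real (-x)" using z(2) by (simp add: eq_neg_iff_add_eq_0)
    moreover have "cnj z = inverse z" using z(1)
      by (simp add: complex_eq_iff cmod_def complex_inverse power2_eq_square)
    ultimately have "poly R (inverse z) = poly R z"
      using poly_map_poly_cnj[of R z] R(1) by simp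
    moreover have "z \<noteq> 0" using z by auto
    ultimately have "poly T z = 0"
      by (simp add: T_def poly_reflect_poly_nz poly_monom d_def)
    moreover have "x = - Re (poly R z)" using \<open>poly R z = of_real (-x)\<close> by simp
    ultimately show "x \<in> (\<lambda>z. - Re (poly R z)) ` {z. poly T z = 0}" by blast
  qed
  ultimately show ?thesis by (rule rev_finite_subset)
qed

section \<open>Measurability of the number of roots\<close>

text \<open>Superlevel sets are the convenient ones here: having at least \<open>k\<close> roots in
  a set is an existence statement, having exactly \<open>k\<close> is not.\<close>

lemma measurable_nat_geI:
  fixes f :: "'a \<Rightarrow> nat"
  assumes "\<And>k. {\<omega> \<in> space M. k \<le> f \<omega>} \<in> sets M"
  shows "f \<in> measurable M (count_space UNIV)"
proof (subst measurable_count_space_eq2_countable, safe)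
  fix k
  have "f -` {k} \<inter> space M = {\<omega> \<in> space M. k \<le> f \<omega>} - {\<omega> \<in> space M. Suc k \<le> f \<omega>}"
    by auto
  then show "f -` {k} \<inter> space M \<in> sets M" using assms by auto
qed auto

lemma continuous_on_coeff_mult:
  fixes P Q :: "'a::topological_space \<Rightarrow> complex poly"
  assumes "\<And>i. continuous_on A (\<lambda>x. coeff (P x) i)" "\<And>i. continuous_on A (\<lambda>x. coeff (Q x) i)"
  shows "continuous_on A (\<lambda>x. coeff (P x * Q x) i)"
  unfolding coeff_mult by (intro continuous_intros assms)

lemma continuous_on_coeff_prod:
  fixes P :: "nat \<Rightarrow> 'a::topological_space \<Rightarrow> complex poly"
  assumes "\<And>l i. continuous_on A (\<lambda>x. coeff (P l x) i)"
  shows "continuous_on A (\<lambda>x. coeff (\<Prod>l<k. P l x) i)"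
proof (induction k arbitrary: i)
  case (Suc k)
  show ?case unfolding prod.lessThan_Suc by (intro continuous_on_coeff_mult Suc assms)
qed simp

text \<open>Tychonoff's theorem. Roots and cofactor coefficients are both coded below as infinite
  sequences, so one function space serves for all \<open>k\<close> and \<open>n\<close>.\<close>

lemma compact_Pi_UNIV:
  fixes S :: "complex set"
  assumes "compact S"
  shows "compact (PiE UNIV (\<lambda>_::nat. S))"
  using assms unfolding compactin_euclidean_iff[symmetric] euclidean_product_topology[symmetric]
  by (simp add: compactin_PiE)

text \<open>Splitting off \<open>k\<close> linear factors counts roots with multiplicity. The guard
  \<open>k > 0\<close> is there because \<open>z\<close> is a total sequence: for
  \<open>k = 0\<close> the set \<open>S\<close> may be empty and no sequence in it exists.\<close>

lemma size_filter_proots_ge_iff: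
  fixes q :: "complex poly"
  assumes "q \<noteq> 0" "degree q \<le> n"
  shows "k \<le> size (filter_mset (\<lambda>z. z \<in> S) (proots q)) \<longleftrightarrow>
    (\<exists>z b. (k > 0 \<longrightarrow> (\<forall>l. z l \<in> S)) \<and> q = (\<Prod>l<k. [:- z l, 1:]) * (\<Sum>i\<le>n. monom (b i) i))"
    (is "?L \<longleftrightarrow> ?R")
proof
  assume L: ?L
  obtain xs where xs: "mset xs = filter_mset (\<lambda>z. z \<in> S) (proots q)" by (meson ex_mset)
  have len: "k \<le> length xs" using L by (simp flip: size_mset add: xs)
  have inS: "xs ! l \<in> S" if "l < length xs" for l
    using that by (metis filter_mset_eq_conv mem_Collect_eq nth_mem set_mset_filter set_mset_mset xs)
  \<comment> \<open>The surplus roots in \<open>S\<close> and all roots outside \<open>S\<close> go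
    into the cofactor, together with the leading coefficient.\<close>
  define rest where "rest = mset (drop k xs) + filter_mset (\<lambda>z. z \<notin> S) (proots q)"
  define B where "B = smult (lead_coeff q) (\<Prod>x\<in>#rest. [:-x, 1:])"
  have "mset xs = mset (take k xs) + mset (drop k xs)" by (metis append_take_drop_id mset_append)
  then have "proots q = mset (take k xs) + rest"
    unfolding rest_def by (metis add.assoc multiset_partition xs)
  moreover have "(\<Prod>x\<in>#mset (take k xs). [:-x, 1:]) = (\<Prod>l<k. [:- (xs ! l), 1:])"
    using len by (simp add: prod_mset_prod_list flip: mset_map)
      (simp add: prod.list_conv_set_nth atLeast0LessThan min_def)
  ultimately have "(\<Prod>x\<in>#proots q. [:-x, 1:]) =
      (\<Prod>l<k. [:- (xs ! l), 1:]) * (\<Prod>x\<in>#rest. [:-x, 1:])" by simp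
  then have q: "q = (\<Prod>l<k. [:- (xs ! l), 1:]) * B"
    unfolding B_def by (metis complex_poly_decompose_multiset mult_smult_right)
  have "B dvd q" by (subst q) simp
  then have "degree B \<le> n" using assms by (meson dvd_imp_degree_le order_trans)
  then have B: "B = (\<Sum>i\<le>n. monom (coeff B i) i)" by (simp add: poly_as_sum_of_monoms')
  \<comment> \<open>Beyond index \<open>k\<close> the first root is repeated, so that every value of
    \<open>z\<close> lies in \<open>S\<close>.\<close>
  define z where "z l = (if l < k then xs ! l else xs ! 0)" for l
  have "k > 0 \<longrightarrow> (\<forall>l. z l \<in> S)" using inS len
    by (auto simp: z_def intro!: inS)
  moreover have "q = (\<Prod>l<k. [:- z l, 1:]) * (\<Sum>i\<le>n. monom (coeff B i) i)"
    unfolding B[symmetric] by (subst q) (simp add: z_def)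
  ultimately show ?R by blast
next
  assume ?R
  then obtain z b where zb: "k > 0 \<longrightarrow> (\<forall>l. z l \<in> S)"
    "q = (\<Prod>l<k. [:- z l, 1:]) * (\<Sum>i\<le>n. monom (b i) i)" by blast
  define B where "B = (\<Sum>i\<le>n. monom (b i) i)"
  have "B \<noteq> 0" using zb assms by (auto simp: B_def)
  moreover have "(\<Prod>l<k. [:- z l, 1:]) \<noteq> 0" by (simp add: prod_zero_iff)
  ultimately have "proots q = (\<Sum>l<k. {#z l#}) + proots B"
    unfolding zb(2) B_def[symmetric] by (simp add: proots_mult proots_prod)
  then have "filter_mset (\<lambda>z. z \<in> S) (\<Sum>l<k. {#z l#}) \<subseteq># filter_mset (\<lambda>z. z \<in> S) (proots q)"
    by simp
  moreover have "size (filter_mset (\<lambda>z. z \<in> S) (\<Sum>l<j. {#z l#})) = j" if "j \<le> k" for j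
    using that zb(1) by (induction j) auto
  ultimately show ?L by (metis order_refl size_mset_mono)
qed

text \<open>With the roots confined to \<open>S\<close> and the cofactor bounded by \<open>j\<close>, the coefficient vectors of
  the products form a compact set, so those with at least \<open>k\<close> roots in \<open>S\<close> form an
  \<open>F\<^sub>\<sigma>\<close> set.\<close>

lemma measurable_num_roots_compact:
  fixes a :: "nat \<Rightarrow> 'a \<Rightarrow> real"
  assumes S: "compact S" and a: "\<And>i. i \<le> n \<Longrightarrow> a i \<in> borel_measurable M"
  shows "(\<lambda>\<omega>. size (filter_mset (\<lambda>z. z \<in> S) (proots (difference_char_poly n (\<lambda>i. a i \<omega>)))))
    \<in> measurable M (count_space UNIV)"
proof (rule measurable_nat_geI)
  fix k :: nat
  define q where "q \<omega> = difference_char_poly n (\<lambda>i. a i \<omega>)" for \<omega>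
  have dq: "degree (q \<omega>) \<le> n" for \<omega> by (simp add: q_def degree_difference_char_poly_le)
  have q_meas: "(\<lambda>\<omega>. coeff (q \<omega>)) \<in> borel_measurable M"
  proof (rule measurable_coordinatewise_then_product)
    fix i
    show "(\<lambda>\<omega>. coeff (q \<omega>) i) \<in> borel_measurable M"
      using a by (cases "i \<le> n") (simp_all add: q_def coeff_difference_char_poly)
  qed
  define F where "F = (\<lambda>(z, b). coeff ((\<Prod>l<k. [:- z l, 1:]) * (\<Sum>i\<le>n. monom (b i) i)) :: nat \<Rightarrow> complex)"
  define K where "K j = PiE UNIV (\<lambda>_::nat. S) \<times> PiE UNIV (\<lambda>_::nat. cball 0 (real j) :: complex set)" for j
  have "continuous_on UNIV F"
  proof -
    have z: "continuous_on UNIV (\<lambda>x::(nat \<Rightarrow> complex) \<times> (nat \<Rightarrow> complex). coeff [:- fst x l, 1:] i)" for l i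
    proof -
      have "continuous_on UNIV (\<lambda>x::(nat \<Rightarrow> complex) \<times> (nat \<Rightarrow> complex). fst x l)"
        by (rule continuous_on_product_then_coordinatewise) (intro continuous_intros)
      then show ?thesis by (cases i) (simp_all add: continuous_on_minus)
    qed
    have b: "continuous_on UNIV
        (\<lambda>x::(nat \<Rightarrow> complex) \<times> (nat \<Rightarrow> complex). coeff (\<Sum>i\<le>n. monom (snd x i) i) j)" for j
    proof -
      have "continuous_on UNIV (\<lambda>x::(nat \<Rightarrow> complex) \<times> (nat \<Rightarrow> complex). snd x i)" for i
        by (rule continuous_on_product_then_coordinatewise) (intro continuous_intros)
      then show ?thesis by (cases "j \<le> n") (simp_all add: coeff_sum)
    qed
    show ?thesis unfolding F_def split_beta
      by (intro continuous_on_coordinatewise_then_product continuous_on_coeff_mult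
          continuous_on_coeff_prod z b)
  qed
  then have "compact (F ` K j)" for j
    unfolding K_def
    by (intro compact_continuous_image compact_Times compact_Pi_UNIV S compact_cball)
      (blast intro: continuous_on_subset)
  then have "closed (F ` K j)" for j by (rule compact_imp_closed)
  then have U: "(\<Union>j. F ` K j) \<in> sets borel" by (intro sets.countable_UN) auto
  have ge_iff: "k \<le> size (filter_mset (\<lambda>z. z \<in> S) (proots (q \<omega>))) \<longleftrightarrow> coeff (q \<omega>) \<in> (\<Union>j. F ` K j)"
    if q0: "q \<omega> \<noteq> 0" and k: "k > 0" for \<omega>
  proof -
    have "\<exists>j. b \<in> PiE UNIV (\<lambda>_. cball 0 (real j))" if "\<forall>i>n. b i = 0" for b :: "nat \<Rightarrow> complex"
    proof -
      obtain j where j: "(\<Sum>i\<le>n. cmod (b i)) \<le> real j" using real_arch_simple by blast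
      have "cmod (b i) \<le> real j" for i
        using member_le_sum[of i "{..n}" "\<lambda>i. cmod (b i)"] j that
        by (cases "i \<le> n") (auto intro: order_trans)
      then show ?thesis by (intro exI[of _ j]) auto
    qed
    note bounded = this
    have "(\<exists>z b. (\<forall>l. z l \<in> S) \<and> q \<omega> = (\<Prod>l<k. [:- z l, 1:]) * (\<Sum>i\<le>n. monom (b i) i))
        \<longleftrightarrow> coeff (q \<omega>) \<in> (\<Union>j. F ` K j)"
    proof
      assume "\<exists>z b. (\<forall>l. z l \<in> S) \<and> q \<omega> = (\<Prod>l<k. [:- z l, 1:]) * (\<Sum>i\<le>n. monom (b i) i)"
      then obtain z b where z: "\<forall>l. z l \<in> S"
        and e: "q \<omega> = (\<Prod>l<k. [:- z l, 1:]) * (\<Sum>i\<le>n. monom (b i) i)" by blast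
      \<comment> \<open>Entries beyond \<open>n\<close> do not affect the product but could be
        unbounded. Cutting them off leaves finitely many non-zero entries and puts the pair into
        some \<open>K j\<close>.\<close>
      define b' where "b' i = (if i \<le> n then b i else 0)" for i
      obtain j where "b' \<in> PiE UNIV (\<lambda>_. cball 0 (real j))" using bounded[of b'] by (auto simp: b'_def)
      with z have "(z, b') \<in> K j" by (auto simp: K_def)
      moreover have "(\<Sum>i\<le>n. monom (b' i) i) = (\<Sum>i\<le>n. monom (b i) i)" by (simp add: b'_def)
      then have "coeff (q \<omega>) = F (z, b')" by (simp add: F_def e)
      ultimately show "coeff (q \<omega>) \<in> (\<Union>j. F ` K j)" by blast
    next
      assume "coeff (q \<omega>) \<in> (\<Union>j. F ` K j)"
      then obtain j z b where zb: "(z, b) \<in> K j" "coeff (q \<omega>) = F (z, b)" by auto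
      have "z l \<in> S" for l using zb(1) by (auto simp: K_def)
      moreover have "q \<omega> = (\<Prod>l<k. [:- z l, 1:]) * (\<Sum>i\<le>n. monom (b i) i)"
        using zb(2) by (simp add: F_def coeff_inject)
      ultimately show "\<exists>z b. (\<forall>l. z l \<in> S) \<and> q \<omega> = (\<Prod>l<k. [:- z l, 1:]) * (\<Sum>i\<le>n. monom (b i) i)"
        by blast
    qed
    then show ?thesis using size_filter_proots_ge_iff[OF q0 dq, of k S] k by simp
  qed
  show "{\<omega> \<in> space M. k \<le> size (filter_mset (\<lambda>z. z \<in> S)
      (proots (difference_char_poly n (\<lambda>i. a i \<omega>))))} \<in> sets M"
  proof (cases "k = 0")
    case False
    \<comment> \<open>The zero vector is removed by hand: it is a product with zero cofactor,
      whereas \<open>proots 0\<close> is empty and has fewer than \<open>k\<close> elements.\<close>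
    have iff: "k \<le> size (filter_mset (\<lambda>z. z \<in> S) (proots (q \<omega>))) \<longleftrightarrow>
        coeff (q \<omega>) \<in> (\<Union>j. F ` K j) \<and> coeff (q \<omega>) \<noteq> (\<lambda>_. 0)" for \<omega>
    proof (cases "q \<omega> = 0")
      case True
      then show ?thesis using False by (simp add: fun_eq_iff)
    next
      case q0: False
      then have "coeff (q \<omega>) \<noteq> (\<lambda>_. 0)" by (metis coeff_0 poly_eqI)
      then show ?thesis using ge_iff[OF q0] False by simp
    qed
    have "{\<omega> \<in> space M. k \<le> size (filter_mset (\<lambda>z. z \<in> S) (proots (q \<omega>)))}
      = ((\<lambda>\<omega>. coeff (q \<omega>)) -` (\<Union>j. F ` K j) \<inter> space M) - ((\<lambda>\<omega>. coeff (q \<omega>)) -` {\<lambda>_. 0} \<inter> space M)"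
      using iff by auto
    moreover have "\<dots> \<in> sets M"
      by (intro sets.Diff measurable_sets[OF q_meas] U) auto
    ultimately show ?thesis unfolding q_def by simp
  qed simp
qed

text \<open>The open disc is exhausted by compact discs. A polynomial has finitely many roots in it,
  so some compact disc already contains them all and the count is attained.\<close>

lemma measurable_num_roots_unit_disc:
  fixes a :: "nat \<Rightarrow> 'a \<Rightarrow> real"
  assumes a: "\<And>i. i \<le> n \<Longrightarrow> a i \<in> borel_measurable M"
  shows "(\<lambda>\<omega>. num_roots_unit_disc (difference_char_poly n (\<lambda>i. a i \<omega>))) \<in> measurable M (count_space UNIV)"
proof (rule measurable_nat_geI)
  fix k :: nat
  define q where "q \<omega> = difference_char_poly n (\<lambda>i. a i \<omega>)" for \<omega>
  define N where "N j \<omega> = size (filter_mset (\<lambda>z. z \<in> cball 0 (1 - inverse (real (Suc j)))) (proots (q \<omega>)))"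
    for j \<omega>
  have [measurable]: "N j \<in> measurable M (count_space UNIV)" for j
    unfolding N_def q_def by (rule measurable_num_roots_compact[OF compact_cball a])
  have le: "N j \<omega> \<le> num_roots_unit_disc (q \<omega>)" for j \<omega>
  proof -
    have "filter_mset (\<lambda>z. z \<in> cball 0 (1 - inverse (real (Suc j)))) (proots (q \<omega>)) =
        filter_mset (\<lambda>z. z \<in> cball 0 (1 - inverse (real (Suc j))))
          (filter_mset (\<lambda>z. cmod z < 1) (proots (q \<omega>)))"
      by (auto simp: filter_filter_mset intro!: filter_mset_cong intro: le_less_trans)
    then show ?thesis unfolding N_def num_roots_unit_disc_def
      by (metis size_filter_mset_lesseq)
  qed
  have eq: "\<exists>j. N j \<omega> = num_roots_unit_disc (q \<omega>)" for \<omega>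
  proof -
    \<comment> \<open>The point 0 is inserted so that \<open>Max\<close> is taken over a non-empty
      set; it does not spoil the bound by 1.\<close>
    define Z where "Z = insert 0 {z \<in> set_mset (proots (q \<omega>)). cmod z < 1}"
    have Z: "finite Z" "Z \<noteq> {}" by (auto simp: Z_def)
    have "Max (cmod ` Z) < 1" using Z by (subst Max_less_iff) (auto simp: Z_def)
    then obtain j where j: "inverse (real (Suc j)) < 1 - Max (cmod ` Z)"
      using reals_Archimedean[of "1 - Max (cmod ` Z)"] by auto
    have "z \<in> cball 0 (1 - inverse (real (Suc j))) \<longleftrightarrow> cmod z < 1" if "z \<in># proots (q \<omega>)" for z
    proof
      assume "cmod z < 1"
      then have "z \<in> Z" using that by (simp add: Z_def)
      then have "cmod z \<le> Max (cmod ` Z)" using Z by simp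
      then show "z \<in> cball 0 (1 - inverse (real (Suc j)))" using j by simp
    qed (auto intro: le_less_trans)
    then show ?thesis unfolding N_def num_roots_unit_disc_def
      by (intro exI[of _ j] arg_cong[of _ _ size] filter_mset_cong) auto
  qed
  have "{\<omega> \<in> space M. k \<le> num_roots_unit_disc (q \<omega>)} = {\<omega> \<in> space M. \<exists>j. k \<le> N j \<omega>}"
    using le eq by (auto intro: order_trans) (metis)
  also have "\<dots> \<in> sets M" by measurable
  finally show "{\<omega> \<in> space M. k \<le> num_roots_unit_disc (difference_char_poly n (\<lambda>i. a i \<omega>))} \<in> sets M"
    by (simp add: q_def)
qed

section \<open>The ratio of two normal variables\<close>

text \<open>The exponents add up to that of a single normal density at \<open>c * y\<close> with
  \<open>c = sqrt (1 + s\<^sup>2)\<close>. Rescaling leaves the absolute first moment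
  \<open>sqrt (2 / pi)\<close> of a standard normal variable.\<close>

lemma nn_integral_abs_normal_product:
  "(\<integral>\<^sup>+y. ennreal (\<bar>y\<bar> * (std_normal_density (y * s) * std_normal_density y)) \<partial>lborel)
    = ennreal (inverse (1 + s\<^sup>2) / pi)"
proof -
  define c where "c = sqrt (1 + s\<^sup>2)"
  have c: "c > 0" "c\<^sup>2 = 1 + s\<^sup>2"
    unfolding c_def by (simp_all add: add_pos_nonneg)
  have m: "(\<integral>\<^sup>+x. ennreal (std_normal_density x * \<bar>x\<bar>) \<partial>lborel) = ennreal (sqrt (2 / pi))"
    using std_normal_moment_abs_odd[of 0]
    by (subst nn_integral_eq_integral) (auto simp: has_bochner_integral_iff)
  \<comment> \<open>The form \<open>0 + c * y\<close> anticipates the affine substitution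
    rule.\<close>
  have f: "\<bar>y\<bar> * (std_normal_density (y * s) * std_normal_density y) =
      (1 / (sqrt (2 * pi) * c)) * (std_normal_density (0 + c * y) * \<bar>0 + c * y\<bar>)" for y
  proof -
    have "exp (- (y * s)\<^sup>2 / 2) * exp (- y\<^sup>2 / 2) = exp (- (c * y)\<^sup>2 / 2)"
      unfolding power_mult_distrib c by (simp add: algebra_simps flip: exp_add)
    then show ?thesis using c(1) by (simp add: std_normal_density_def abs_mult field_simps)
  qed
  have "(\<integral>\<^sup>+y. ennreal (\<bar>y\<bar> * (std_normal_density (y * s) * std_normal_density y)) \<partial>lborel)
      = ennreal (1 / (sqrt (2 * pi) * c)) *
        (\<integral>\<^sup>+y. ennreal (std_normal_density (0 + c * y) * \<bar>0 + c * y\<bar>) \<partial>lborel)"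
    unfolding f using c(1) by (subst ennreal_mult) (auto simp: nn_integral_cmult)
  also have "(\<integral>\<^sup>+y. ennreal (std_normal_density (0 + c * y) * \<bar>0 + c * y\<bar>) \<partial>lborel)
      = ennreal (sqrt (2 / pi) / c)"
  proof -
    have "ennreal (sqrt (2 / pi)) = ennreal c *
        (\<integral>\<^sup>+y. ennreal (std_normal_density (0 + c * y) * \<bar>0 + c * y\<bar>) \<partial>lborel)"
      using nn_integral_real_affine[of "\<lambda>x. ennreal (std_normal_density x * \<bar>x\<bar>)" c 0] c(1) m by simp
    then have "ennreal (1 / c) * ennreal (sqrt (2 / pi)) = (ennreal (1 / c) * ennreal c) *
        (\<integral>\<^sup>+y. ennreal (std_normal_density (0 + c * y) * \<bar>0 + c * y\<bar>) \<partial>lborel)"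
      by (simp add: mult.assoc)
    then show ?thesis using c(1) by (simp flip: ennreal_mult')
  qed
  also have "ennreal (1 / (sqrt (2 * pi) * c)) * ennreal (sqrt (2 / pi) / c) =
      ennreal (1 / (sqrt (2 * pi) * c) * (sqrt (2 / pi) / c))"
    using c(1) by (intro ennreal_mult'[symmetric]) simp
  also have "1 / (sqrt (2 * pi) * c) * (sqrt (2 / pi) / c) = inverse (c\<^sup>2) / pi"
    using c(1) by (simp add: real_sqrt_mult real_sqrt_divide power2_eq_square field_simps)
  finally show ?thesis unfolding c .
qed

text \<open>The two endpoints are null, so the open interval may be closed and
  \<open>arctan s / pi\<close> used as antiderivative.\<close>

lemma nn_integral_cauchy_density_Ioo:
  assumes "t \<ge> 0"
  shows "(\<integral>\<^sup>+s. ennreal (inverse (1 + s\<^sup>2) / pi) * indicator {s. \<bar>s\<bar> < t} s \<partial>lborel)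
    = ennreal (2 / pi * arctan t)"
proof -
  have "AE s in lborel. ennreal (inverse (1 + s\<^sup>2) / pi) * indicator {s. \<bar>s\<bar> < t} s
      = ennreal (inverse (1 + s\<^sup>2) / pi) * indicator {-t..t} s"
    using AE_lborel_singleton[of t] AE_lborel_singleton[of "-t"]
    by eventually_elim (auto simp: indicator_def)
  then have "(\<integral>\<^sup>+s. ennreal (inverse (1 + s\<^sup>2) / pi) * indicator {s. \<bar>s\<bar> < t} s \<partial>lborel)
      = (\<integral>\<^sup>+s. ennreal (inverse (1 + s\<^sup>2) / pi) * indicator {-t..t} s \<partial>lborel)"
    by (rule nn_integral_cong_AE)
  also have "\<dots> = ennreal (arctan t / pi - arctan (-t) / pi)"
    using assms
    by (intro nn_integral_FTC_Icc)
      (auto intro!: derivative_eq_intros simp: add_nonneg_nonneg divide_inverse)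
  also have "arctan t / pi - arctan (-t) / pi = 2 / pi * arctan t"
    by (simp add: arctan_minus)
  finally show ?thesis .
qed

text \<open>Substituting \<open>x = y s\<close> in the inner integral and swapping the integrals leaves the
  Cauchy density in \<open>s\<close>.\<close>

lemma (in prob_space) prob_abs_normal_less:
  assumes indep: "indep_var borel X borel Y"
    and X: "distributed M lborel X std_normal_density"
    and Y: "distributed M lborel Y std_normal_density"
    and t: "t \<ge> 0"
  shows "prob {\<omega> \<in> space M. \<bar>X \<omega>\<bar> < t * \<bar>Y \<omega>\<bar>} = 2 / pi * arctan t"
proof -
  let ?\<phi> = "std_normal_density"
  have [measurable]: "X \<in> borel_measurable M" "Y \<in> borel_measurable M"
    using X Y by (auto simp: distributed_def)
  have "indep_var lborel X lborel Y"
    using indep_var_compose[OF indep, of id lborel id lborel] by simp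
  then have d: "distributed M (lborel \<Otimes>\<^sub>M lborel) (\<lambda>x. (X x, Y x)) (\<lambda>(x, y). ennreal (?\<phi> x) * ennreal (?\<phi> y))"
    by (intro distributed_joint_indep X Y lborel.sigma_finite_measure_axioms)
  define B where "B = {z::real \<times> real. \<bar>fst z\<bar> < t * \<bar>snd z\<bar>}"
  have "{z \<in> space (borel \<Otimes>\<^sub>M borel). \<bar>fst z\<bar> < t * \<bar>snd z\<bar>} \<in> sets (borel \<Otimes>\<^sub>M borel)"
    by measurable
  then have [measurable]: "B \<in> sets (borel \<Otimes>\<^sub>M borel)"
    by (simp add: B_def space_pair_measure)
  then have B: "B \<in> sets (lborel \<Otimes>\<^sub>M lborel)"
    by (simp cong: sets_pair_measure_cong)
  have "emeasure M {\<omega> \<in> space M. \<bar>X \<omega>\<bar> < t * \<bar>Y \<omega>\<bar>} = emeasure M ((\<lambda>x. (X x, Y x)) -` B \<inter> space M)"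
    by (auto simp: B_def intro!: arg_cong[of _ _ "emeasure M"])
  also have "\<dots> = (\<integral>\<^sup>+z. (case z of (x, y) \<Rightarrow> ennreal (?\<phi> x) * ennreal (?\<phi> y)) * indicator B z \<partial>(lborel \<Otimes>\<^sub>M lborel))"
    by (rule distributed_emeasure[OF d B])
  also have "\<dots> = (\<integral>\<^sup>+y. \<integral>\<^sup>+x. ennreal (?\<phi> x) * ennreal (?\<phi> y) * indicator B (x, y) \<partial>lborel \<partial>lborel)"
    using B by (subst lborel_pair.nn_integral_snd[symmetric]) auto
  also have "\<dots> = (\<integral>\<^sup>+y. \<integral>\<^sup>+s. ennreal (\<bar>y\<bar> * (?\<phi> (y * s) * ?\<phi> y)) * indicator {s. \<bar>s\<bar> < t} s \<partial>lborel \<partial>lborel)"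
  proof (rule nn_integral_cong)
    fix y :: real
    show "(\<integral>\<^sup>+x. ennreal (?\<phi> x) * ennreal (?\<phi> y) * indicator B (x, y) \<partial>lborel) =
      (\<integral>\<^sup>+s. ennreal (\<bar>y\<bar> * (?\<phi> (y * s) * ?\<phi> y)) * indicator {s. \<bar>s\<bar> < t} s \<partial>lborel)"
    \<comment> \<open>The substitution degenerates at \<open>y = 0\<close>. There the slice of
      \<open>B\<close> is empty and the factor \<open>\<bar>y\<bar>\<close> vanishes, so both sides
      are 0.\<close>
    proof (cases "y = 0")
      case True
      then show ?thesis by (simp add: B_def)
    next
      case False
      have ind: "indicator B (0 + y * s, y) = (indicator {s. \<bar>s\<bar> < t} s :: ennreal)" for s
        using False by (simp add: B_def indicator_def abs_mult mult.commute)
      have "(\<integral>\<^sup>+x. ennreal (?\<phi> x) * ennreal (?\<phi> y) * indicator B (x, y) \<partial>lborel) =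
        ennreal \<bar>y\<bar> * (\<integral>\<^sup>+s. ennreal (?\<phi> (0 + y * s)) * ennreal (?\<phi> y) * indicator B (0 + y * s, y) \<partial>lborel)"
        using False by (intro nn_integral_real_affine) measurable
      also have "\<dots> = (\<integral>\<^sup>+s. ennreal \<bar>y\<bar> * (ennreal (?\<phi> (0 + y * s)) * ennreal (?\<phi> y) * indicator B (0 + y * s, y)) \<partial>lborel)"
        by (intro nn_integral_cmult[symmetric]) (simp add: ind)
      also have "\<dots> = (\<integral>\<^sup>+s. ennreal (\<bar>y\<bar> * (?\<phi> (y * s) * ?\<phi> y)) * indicator {s. \<bar>s\<bar> < t} s \<partial>lborel)"
        unfolding ind by (intro nn_integral_cong) (simp add: ennreal_mult' mult_ac)
      finally show ?thesis .
    qed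
  qed
  also have "\<dots> = (\<integral>\<^sup>+s. \<integral>\<^sup>+y. ennreal (\<bar>y\<bar> * (?\<phi> (y * s) * ?\<phi> y)) * indicator {s. \<bar>s\<bar> < t} s \<partial>lborel \<partial>lborel)"
    by (rule lborel_pair.Fubini') measurable
  also have "\<dots> = (\<integral>\<^sup>+s. ennreal (inverse (1 + s\<^sup>2) / pi) * indicator {s. \<bar>s\<bar> < t} s \<partial>lborel)"
    by (intro nn_integral_cong) (simp add: nn_integral_multc nn_integral_abs_normal_product)
  also have "\<dots> = ennreal (2 / pi * arctan t)"
    by (rule nn_integral_cauchy_density_Ioo[OF t])
  finally show ?thesis using t by (simp add: measure_def)
qed

section \<open>Roots on the circle and reversal\<close>

lemma difference_char_poly_cong:
  "(\<And>i. i \<le> n \<Longrightarrow> a i = b i) \<Longrightarrow> difference_char_poly n a = difference_char_poly n b"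
  by (simp add: difference_char_poly_def)

lemma root_of_size_filter_proots:
  assumes "0 < size (filter_mset P (proots q))"
  shows "\<exists>z. P z \<and> poly q z = 0"
proof -
  define F where "F = filter_mset P (proots q)"
  have "F \<noteq> {#}" using assms unfolding F_def[symmetric] by auto
  then have "set_mset F \<noteq> {}" by simp
  then obtain z where "z \<in> set_mset F" by (auto simp only: ex_in_conv[symmetric])
  then have z: "z \<in># proots q" "P z"
    unfolding F_def by (simp_all only: set_mset_filter mem_Collect_eq)
  have "q \<noteq> 0" using z(1) by (cases "q = 0") simp_all
  then show ?thesis using z by auto
qed

lemma (in prob_space) indep_vars_reindex:
  assumes inj: "inj_on f I" and X: "indep_vars M' X (f ` I)"
  shows "indep_vars (\<lambda>i. M' (f i)) (\<lambda>i. X (f i)) I"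
  unfolding indep_vars_def2
proof
  show "\<forall>i\<in>I. random_variable (M' (f i)) (X (f i))" using X by (auto simp: indep_vars_def2)
  have ind: "indep_sets (\<lambda>i. {X i -` A \<inter> space M |A. A \<in> sets (M' i)}) (f ` I)"
    using X by (simp add: indep_vars_def2)
  show "indep_sets (\<lambda>i. {X (f i) -` A \<inter> space M |A. A \<in> sets (M' (f i))}) I"
  proof (rule indep_setsI)
    show "{X (f i) -` A \<inter> space M |A. A \<in> sets (M' (f i))} \<subseteq> events" if "i \<in> I" for i
      using ind that by (auto simp: indep_sets_def)
    fix A J
    assume J: "J \<noteq> {}" "J \<subseteq> I" "finite J"
      "\<forall>j\<in>J. A j \<in> {X (f j) -` A \<inter> space M |A. A \<in> sets (M' (f j))}"
    define g where "g = the_inv_into I f"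
    have g: "g (f j) = j" if "j \<in> J" for j
      using that J inj by (auto simp: g_def the_inv_into_f_f)
    have injJ: "inj_on f J" using inj J by (blast intro: inj_on_subset)
    have "prob (\<Inter>k\<in>f ` J. A (g k)) = (\<Prod>k\<in>f ` J. prob (A (g k)))"
      using J by (intro indep_setsD[OF ind]) (auto simp: g)
    then show "prob (\<Inter>j\<in>J. A j) = (\<Prod>j\<in>J. prob (A j))"
      by (simp add: prod.reindex[OF injJ] g)
  qed
qed

lemma (in prob_space) AE_notin_finite:
  fixes X :: "'a \<Rightarrow> real"
  assumes X: "distributed M lborel X f" and S: "finite S"
  shows "AE \<omega> in M. X \<omega> \<notin> S"
proof -
  have "S \<in> null_sets lborel" using S by (rule finite_imp_null_set_lborel)
  then have "AE x in lborel. 0 < f x \<longrightarrow> x \<notin> S" by (auto dest: AE_not_in)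
  moreover have "S \<in> sets borel" using S by (simp add: finite_imp_closed)
  then have "Measurable.pred lborel (\<lambda>x. x \<notin> S)" by measurable
  ultimately show ?thesis by (subst distributed_AE2[OF X]) auto
qed

text \<open>For fixed \<open>a 1, \<dots>, a n\<close> only finitely many values of \<open>a 0\<close> produce a root on the circle,
  so Fubini applies to the joint law.\<close>

lemma (in prob_space) AE_no_root_on_circle:
  fixes A :: "nat \<Rightarrow> 'a \<Rightarrow> real"
  assumes indep: "indep_vars (\<lambda>_. borel) A {0..n}"
    and dens: "\<And>i. i \<le> n \<Longrightarrow> distributed M lborel (A i) (f i)"
  shows "AE \<omega> in M. \<forall>z. cmod z = 1 \<longrightarrow> poly (difference_char_poly n (\<lambda>i. A i \<omega>)) z \<noteq> 0"
proof -
  have rv: "random_variable borel (A i)" if "i \<le> n" for i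
    using dens[OF that] by (auto simp: distributed_def)
  \<comment> \<open>Outside \<open>{0..n}\<close> a point mass is used, since the product locale
    asks for a probability measure at every index.\<close>
  define D where "D i = (if i \<le> n then distr M borel (A i) else return borel 0)" for i
  have D0: "D 0 = distr M borel (A 0)" by (simp add: D_def)
  have D: "prob_space (D i)" for i
    using rv by (auto simp: D_def intro!: prob_space_distr prob_space_return)
  interpret D: product_prob_space D "{1..n}"
    using D by (simp add: product_prob_space_def product_prob_space_axioms_def
        product_sigma_finite_def prob_space_imp_sigma_finite)
  have setsD [measurable_cong]: "sets (D i) = sets borel" for i by (simp add: D_def)
  define N where "N a = size (filter_mset (\<lambda>z. z \<in> sphere 0 1) (proots (difference_char_poly n a)))"
    for a :: "nat \<Rightarrow> real"
  have N: "N \<in> measurable (PiM {0..n} D) (count_space UNIV)"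
    unfolding N_def using measurable_num_roots_compact[of "sphere 0 1" n "\<lambda>i a. a i" "PiM {0..n} D"]
    by (simp add: measurable_component_singleton cong: measurable_cong_sets)
  define A' where "A' \<omega> = (\<lambda>i\<in>{0..n}. A i \<omega>)" for \<omega>
  have A': "A' \<in> measurable M (PiM {0..n} D)"
    unfolding A'_def using rv by (intro measurable_restrict) (auto simp: setsD cong: measurable_cong_sets)
  have distr: "distr M (PiM {0..n} D) A' = PiM {0..n} D"
  proof -
    have "distr M (PiM {0..n} (\<lambda>_. borel)) A' = PiM {0..n} (\<lambda>i. distr M borel (A i))"
      using indep_vars_iff_distr_eq_PiM'[of "{0..n}" A "\<lambda>_. borel"] indep rv
      unfolding A'_def by auto
    moreover have "distr M (PiM {0..n} (\<lambda>_. borel)) A' = distr M (PiM {0..n} D) A'"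
      by (intro distr_cong sets_PiM_cong) (auto simp: setsD)
    moreover have "PiM {0..n} (\<lambda>i. distr M borel (A i)) = PiM {0..n} D"
      by (intro PiM_cong) (auto simp: D_def)
    ultimately show ?thesis by simp
  qed
  have ins: "{0..n} = insert 0 {1..n}" by auto
  have slice: "(\<integral>\<^sup>+y. indicator {a. N a \<noteq> 0} (x(0 := y)) \<partial>D 0) = 0" for x
  proof -
    define R where "R = difference_char_poly n (x(0 := 0))"
    have R: "difference_char_poly n (x(0 := y)) = R + [:of_real y:]" for y
      by (intro poly_eqI)
        (auto simp: R_def coeff_difference_char_poly coeff_pCons split: nat.split)
    have "finite {y. N (x(0 := y)) \<noteq> 0}"
    \<comment> \<open>Here the polynomial is the constant \<open>y\<close>, and \<open>N\<close> is
      0 for every \<open>y\<close>, including \<open>y = 0\<close> where \<open>proots 0\<close> is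
      empty.\<close>
    proof (cases "R = 0")
      case True
      then show ?thesis by (simp add: N_def R)
    next
      case False
      have "finite {y::real. \<exists>z. cmod z = 1 \<and> poly R z + of_real y = 0}"
        using False by (intro finite_constant_terms_with_circle_root)
          (simp_all add: R_def map_poly_cnj_difference_char_poly coeff_difference_char_poly)
      moreover have "{y. N (x(0 := y)) \<noteq> 0} \<subseteq> {y::real. \<exists>z. cmod z = 1 \<and> poly R z + of_real y = 0}"
      proof safe
        fix y assume "0 < N (x(0 := y))"
        then obtain z where "z \<in> sphere 0 1" "poly (R + [:of_real y:]) z = 0"
          using root_of_size_filter_proots[of "\<lambda>z. z \<in> sphere 0 1"] unfolding N_def R by blast
        then show "\<exists>z. cmod z = 1 \<and> poly R z + complex_of_real y = 0"
          by (intro exI[of _ z]) simp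
      qed
      ultimately show ?thesis by (rule rev_finite_subset)
    qed
    define S where "S = {y. N (x(0 := y)) \<noteq> 0}"
    have S: "finite S" "S \<in> sets borel"
      using \<open>finite {y. N (x(0 := y)) \<noteq> 0}\<close> by (auto simp: S_def finite_imp_closed)
    have "AE \<omega> in M. A 0 \<omega> \<notin> S" using S by (intro AE_notin_finite[OF dens]) auto
    moreover have "{y \<in> space borel. y \<notin> S} = - S" by auto
    ultimately have "AE y in distr M borel (A 0). y \<notin> S"
      using rv[of 0] S by (subst AE_distr_iff) auto
    then have "AE y in D 0. N (x(0 := y)) = 0" unfolding D0 by (simp add: S_def)
    then have "(\<integral>\<^sup>+y. indicator {a. N a \<noteq> 0} (x(0 := y)) \<partial>D 0) = (\<integral>\<^sup>+y. 0 \<partial>D 0)"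
      by (intro nn_integral_cong_AE) (auto simp: indicator_def elim!: eventually_mono)
    then show ?thesis by simp
  qed
  have meas: "indicator {a. N a \<noteq> 0} \<in> borel_measurable (PiM {0..n} D)"
    using N by measurable
  have "(\<integral>\<^sup>+a. indicator {a. N a \<noteq> 0} a \<partial>PiM {0..n} D) = 0"
    using meas slice unfolding ins by (subst D.product_nn_integral_insert) auto
  then have "AE a in PiM {0..n} D. indicator {a. N a \<noteq> 0} a = (0::ennreal)"
    using meas by (subst (asm) nn_integral_0_iff_AE) auto
  then have "AE a in distr M (PiM {0..n} D) A'. N a = 0"
    unfolding distr by (auto simp: indicator_def elim!: eventually_mono split: if_splits)
  then have "AE \<omega> in M. N (A' \<omega>) = 0"
    using N A' by (subst (asm) AE_distr_iff) auto
  \<comment> \<open>The zero polynomial also has \<open>N = 0\<close> although every point is a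
    root. A non-zero leading coefficient rules it out.\<close>
  moreover have "AE \<omega> in M. A n \<omega> \<notin> {0}" by (intro AE_notin_finite[OF dens]) auto
  ultimately show ?thesis
  proof eventually_elim
    case (elim \<omega>)
    have e: "difference_char_poly n (A' \<omega>) = difference_char_poly n (\<lambda>i. A i \<omega>)"
      by (rule difference_char_poly_cong) (simp add: A'_def)
    have "difference_char_poly n (\<lambda>i. A i \<omega>) \<noteq> 0"
      using elim by (auto simp: poly_eq_iff coeff_difference_char_poly)
    show ?case
    proof safe
      fix z assume z: "cmod z = 1" "poly (difference_char_poly n (\<lambda>i. A i \<omega>)) z = 0"
      let ?F = "filter_mset (\<lambda>z. z \<in> sphere 0 1) (proots (difference_char_poly n (\<lambda>i. A i \<omega>)))"
      have "z \<in># ?F" using z \<open>difference_char_poly n (\<lambda>i. A i \<omega>) \<noteq> 0\<close> by simp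
      moreover have "?F = {#}" using elim by (simp add: N_def e)
      ultimately show False by (simp only: set_mset_empty empty_iff)
    qed
  qed
qed

text \<open>The event is the preimage of a measurable set of coefficient vectors, and by
  independence the joint law is the product of the marginals.\<close>

lemma (in prob_space) prob_num_roots_cong:
  fixes A B :: "nat \<Rightarrow> 'a \<Rightarrow> real"
  assumes A: "indep_vars (\<lambda>_. borel) A {0..n}" and B: "indep_vars (\<lambda>_. borel) B {0..n}"
    and AB: "\<And>i. i \<le> n \<Longrightarrow> distr M borel (A i) = distr M borel (B i)"
  shows "prob {\<omega> \<in> space M. num_roots_unit_disc (difference_char_poly n (\<lambda>i. A i \<omega>)) = k} =
    prob {\<omega> \<in> space M. num_roots_unit_disc (difference_char_poly n (\<lambda>i. B i \<omega>)) = k}"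
proof -
  let ?P = "PiM {0..n} (\<lambda>_::nat. borel :: real measure)"
  define E where "E = {a \<in> space ?P. num_roots_unit_disc (difference_char_poly n a) = k}"
  have "(\<lambda>a. num_roots_unit_disc (difference_char_poly n (\<lambda>i. a i))) \<in> measurable ?P (count_space UNIV)"
    by (intro measurable_num_roots_unit_disc measurable_component_singleton) auto
  then have E: "E \<in> sets ?P" unfolding E_def by measurable
  have *: "prob {\<omega> \<in> space M. num_roots_unit_disc (difference_char_poly n (\<lambda>i. C i \<omega>)) = k} =
      measure (PiM {0..n} (\<lambda>i. distr M borel (C i))) E"
    if C: "indep_vars (\<lambda>_. borel) C {0..n}" for C :: "nat \<Rightarrow> 'a \<Rightarrow> real"
  proof -
    have rv: "random_variable borel (C i)" if "i \<in> {0..n}" for i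
      using C that by (auto simp: indep_vars_def)
    have "distr M ?P (\<lambda>\<omega>. \<lambda>i\<in>{0..n}. C i \<omega>) = PiM {0..n} (\<lambda>i. distr M borel (C i))"
      using indep_vars_iff_distr_eq_PiM'[of "{0..n}" C "\<lambda>_. borel"] C rv by auto
    moreover have "(\<lambda>\<omega>. \<lambda>i\<in>{0..n}. C i \<omega>) \<in> measurable M ?P"
      using rv by (intro measurable_restrict)
    moreover have "difference_char_poly n (\<lambda>i\<in>{0..n}. C i \<omega>) = difference_char_poly n (\<lambda>i. C i \<omega>)" for \<omega>
      by (rule difference_char_poly_cong) simp
    ultimately show ?thesis
      using E by (auto simp: measure_distr E_def space_PiM intro!: arg_cong[of _ _ prob]
          simp flip: \<open>distr M ?P _ = _\<close>)
  qed
  have "PiM {0..n} (\<lambda>i. distr M borel (A i)) = PiM {0..n} (\<lambda>i. distr M borel (B i))"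
    by (intro PiM_cong) (auto simp: AB)
  then show ?thesis using *[OF A] *[OF B] by simp
qed

text \<open>The common density \<open>f\<close> acts twice: equal marginals give the reversed
  sequence the same joint law, and absolute continuity makes the exceptional cases of the reflection
  null.\<close>

lemma (in prob_space) prob_num_roots_symmetric:
  fixes A :: "nat \<Rightarrow> 'a \<Rightarrow> real"
  assumes indep: "indep_vars (\<lambda>_. borel) A {0..n}"
    and dens: "\<And>i. i \<le> n \<Longrightarrow> distributed M lborel (A i) f"
    and k: "k \<le> n"
  shows "prob {\<omega> \<in> space M. num_roots_unit_disc (difference_char_poly n (\<lambda>i. A i \<omega>)) = k} =
    prob {\<omega> \<in> space M. num_roots_unit_disc (difference_char_poly n (\<lambda>i. A i \<omega>)) = n - k}"
proof -
  have rv: "random_variable borel (A i)" if "i \<le> n" for i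
    using dens[OF that] by (auto simp: distributed_def)
  have law: "distr M borel (A i) = density lborel f" if "i \<le> n" for i
    unfolding distributed_distr_eq_density[OF dens[OF that], symmetric] by (rule distr_cong) auto
  let ?B = "\<lambda>i. A (n - i)"
  have inj: "inj_on (\<lambda>i. n - i) {0..n}" by (auto simp: inj_on_def)
  have im: "(\<lambda>i. n - i) ` {0..n} = {0..n}"
  proof safe
    fix i assume "i \<in> {0..n}"
    then show "i \<in> (\<lambda>i. n - i) ` {0..n}" by (intro image_eqI[of _ _ "n - i"]) auto
  qed auto
  have B: "indep_vars (\<lambda>_. borel) ?B {0..n}"
    using indep_vars_reindex[OF inj, of "\<lambda>_. borel" A] indep unfolding im by (simp add: o_def)
  have "prob {\<omega> \<in> space M. num_roots_unit_disc (difference_char_poly n (\<lambda>i. A i \<omega>)) = k} =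
      prob {\<omega> \<in> space M. num_roots_unit_disc (difference_char_poly n (\<lambda>i. ?B i \<omega>)) = k}"
    by (rule prob_num_roots_cong[OF indep B]) (simp add: law)
  also have "\<dots> = prob {\<omega> \<in> space M. num_roots_unit_disc (difference_char_poly n (\<lambda>i. A i \<omega>)) = n - k}"
  proof (rule measure_eq_AE)
    have nz: "AE \<omega> in M. A i \<omega> \<noteq> 0" if "i \<le> n" for i
      using AE_notin_finite[OF dens[OF that], of "{0}"] by simp
    have "AE \<omega> in M. A n \<omega> \<noteq> 0" "AE \<omega> in M. A 0 \<omega> \<noteq> 0" by (simp_all add: nz)
    moreover have "AE \<omega> in M. \<forall>z. cmod z = 1 \<longrightarrow> poly (difference_char_poly n (\<lambda>i. A i \<omega>)) z \<noteq> 0"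
      by (rule AE_no_root_on_circle[where f = "\<lambda>_. f"]) (use indep dens in auto)
    ultimately show "AE \<omega> in M. (\<omega> \<in> {\<omega> \<in> space M. num_roots_unit_disc (difference_char_poly n (\<lambda>i. ?B i \<omega>)) = k})
      \<longleftrightarrow> (\<omega> \<in> {\<omega> \<in> space M. num_roots_unit_disc (difference_char_poly n (\<lambda>i. A i \<omega>)) = n - k})"
    proof eventually_elim
      case (elim \<omega>)
      let ?q = "difference_char_poly n (\<lambda>i. A i \<omega>)"
      have "num_roots_unit_disc (difference_char_poly n (\<lambda>i. ?B i \<omega>)) = n - num_roots_unit_disc ?q"
        using elim num_roots_unit_disc_reflect_poly[of ?q]
        by (simp add: difference_char_poly_rev[of "\<lambda>i. A i \<omega>"] degree_difference_char_poly
            coeff_difference_char_poly)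
      moreover have "num_roots_unit_disc ?q \<le> n"
        by (meson num_roots_unit_disc_le degree_difference_char_poly_le order_trans)
      ultimately show ?case using k by auto
    qed
    have "(\<lambda>\<omega>. num_roots_unit_disc (difference_char_poly n (\<lambda>i. C i \<omega>))) \<in> measurable M (count_space UNIV)"
      if "\<And>i. i \<le> n \<Longrightarrow> random_variable borel (C i)" for C
      using that by (rule measurable_num_roots_unit_disc)
    from this[of A] this[of ?B] rv
    show "{\<omega> \<in> space M. num_roots_unit_disc (difference_char_poly n (\<lambda>i. ?B i \<omega>)) = k} \<in> events"
      "{\<omega> \<in> space M. num_roots_unit_disc (difference_char_poly n (\<lambda>i. A i \<omega>)) = n - k} \<in> events"
      by auto
  qed
  finally show ?thesis .
qed

section \<open>Parity of the number of roots\<close>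

lemma poly_difference_char_poly_pm1:
  fixes a :: "nat \<Rightarrow> real" and n :: nat
  defines "u \<equiv> \<Sum>i | i \<le> n \<and> even i. a i" and "v \<equiv> \<Sum>i | i \<le> n \<and> odd i. a i"
  shows "poly (difference_char_poly n a) 1 = complex_of_real (u + v)"
    and "poly (difference_char_poly n a) (-1) = complex_of_real (u - v)"
proof -
  have split: "(\<Sum>i\<le>n. f i) = (\<Sum>i | i \<le> n \<and> even i. f i) + (\<Sum>i | i \<le> n \<and> odd i. f i)"
    for f :: "nat \<Rightarrow> complex"
    by (subst sum.union_disjoint[symmetric]) (auto intro!: sum.cong)
  show "poly (difference_char_poly n a) 1 = complex_of_real (u + v)"
    unfolding poly_difference_char_poly split by (simp add: u_def v_def)
  show "poly (difference_char_poly n a) (-1) = complex_of_real (u - v)"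
    unfolding poly_difference_char_poly split by (simp add: u_def v_def sum_negf)
qed

text \<open>As 1 and -1 lie on the circle, neither is a root, so a tie
  \<open>\<bar>u\<bar> = \<bar>v\<bar>\<close> cannot occur and the strict inequality decides the
  parity.\<close>

lemma odd_num_roots_unit_disc_iff:
  fixes a :: "nat \<Rightarrow> real" and n :: nat
  defines "u \<equiv> \<Sum>i | i \<le> n \<and> even i. a i" and "v \<equiv> \<Sum>i | i \<le> n \<and> odd i. a i"
  assumes "\<And>z. cmod z = 1 \<Longrightarrow> poly (difference_char_poly n a) z \<noteq> 0"
  shows "odd (num_roots_unit_disc (difference_char_poly n a)) \<longleftrightarrow> \<bar>u\<bar> < \<bar>v\<bar>"
proof -
  let ?q = "difference_char_poly n a"
  obtain c where c: "c > 0" "poly ?q 1 * poly ?q (-1) = of_real ((-1) ^ num_roots_unit_disc ?q * c)"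
    using parity_num_roots_unit_disc[of ?q] assms(3) by (auto simp: map_poly_cnj_difference_char_poly)
  have "poly ?q 1 * poly ?q (-1) = complex_of_real ((u + v) * (u - v))"
    unfolding poly_difference_char_poly_pm1 by (simp add: u_def v_def)
  with c have "(u + v) * (u - v) = (-1) ^ num_roots_unit_disc ?q * c"
    by (metis of_real_eq_iff)
  then have "u\<^sup>2 - v\<^sup>2 = (-1) ^ num_roots_unit_disc ?q * c"
    by (simp add: power2_eq_square algebra_simps)
  then have "odd (num_roots_unit_disc ?q) \<longleftrightarrow> u\<^sup>2 < v\<^sup>2" using c(1) by (cases "even (num_roots_unit_disc ?q)") auto
  also have "\<dots> \<longleftrightarrow> \<bar>u\<bar> < \<bar>v\<bar>" using abs_le_square_iff[of v u] by auto
  finally show ?thesis .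
qed

lemma card_even_odd_le:
  "card {i. i \<le> 2 * m \<and> even i} = Suc m" "card {i. i \<le> 2 * m \<and> odd i} = m"
proof -
  have "{i. i \<le> 2 * m \<and> even i} = (\<lambda>j. 2 * j) ` {..m}" by (auto elim!: evenE)
  then show "card {i. i \<le> 2 * m \<and> even i} = Suc m" by (simp add: card_image inj_on_def)
  have "{i. i \<le> 2 * m \<and> odd i} = (\<lambda>j. 2 * j + 1) ` {..<m}" by (auto elim!: oddE)
  then show "card {i. i \<le> 2 * m \<and> odd i} = m" by (simp add: card_image inj_on_def)
qed

text \<open>Variances add, so the standard deviation is the root of the number of summands; dividing
  by it prepares for the ratio formula, stated for standard variables.\<close>

lemma (in prob_space) distributed_normalized_sum:
  assumes "indep_vars (\<lambda>_. borel) A I" "finite I" "I \<noteq> {}"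
    and "\<And>i. i \<in> I \<Longrightarrow> distributed M lborel (A i) std_normal_density"
  shows "distributed M lborel (\<lambda>\<omega>. (\<Sum>i\<in>I. A i \<omega>) / sqrt (card I)) std_normal_density"
proof -
  have "distributed M lborel (\<lambda>\<omega>. \<Sum>i\<in>I. A i \<omega>) (normal_density (\<Sum>i\<in>I. 0) (sqrt (\<Sum>i\<in>I. 1\<^sup>2)))"
    using assms by (intro sum_indep_normal) auto
  moreover have "0 < sqrt (real (card I))" using assms by (simp add: card_gt_0_iff)
  ultimately show ?thesis
    using normal_standard_normal_convert[of "sqrt (real (card I))" "\<lambda>\<omega>. \<Sum>i\<in>I. A i \<omega>" 0] by simp
qed

lemma (in prob_space) prob_odd_num_roots:
  fixes A :: "nat \<Rightarrow> 'a \<Rightarrow> real"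
  assumes indep: "indep_vars (\<lambda>_. borel) A {0..2 * m}"
    and dens: "\<And>i. i \<le> 2 * m \<Longrightarrow> distributed M lborel (A i) std_normal_density"
    and m: "m \<ge> 1"
  shows "prob {\<omega> \<in> space M. odd (num_roots_unit_disc (difference_char_poly (2 * m) (\<lambda>i. A i \<omega>)))}
    = 2 / pi * arctan (sqrt (real m / (real m + 1)))"
proof -
  have rv [measurable]: "random_variable borel (A i)" if "i \<le> 2 * m" for i
    using dens[OF that] by (auto simp: distributed_def)
  define I where "I = {i. i \<le> 2 * m \<and> even i}"
  define J where "J = {i. i \<le> 2 * m \<and> odd i}"
  have I: "finite I" "card I = Suc m" "I \<noteq> {}" "I \<subseteq> {0..2*m}"
    and J: "finite J" "card J = m" "J \<noteq> {}" "J \<subseteq> {0..2*m}"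
    using card_even_odd_le[of m] m by (auto simp: I_def J_def intro: exI[of _ 1])
  define U where "U \<omega> = (\<Sum>i\<in>I. A i \<omega>) / sqrt (card I)" for \<omega>
  define V where "V \<omega> = (\<Sum>i\<in>J. A i \<omega>) / sqrt (card J)" for \<omega>
  \<comment> \<open>The ratio of the standard deviations of the odd and the even sum,
    \<open>sqrt m\<close> over \<open>sqrt (m + 1)\<close>.\<close>
  define t where "t = sqrt (real m / (real m + 1))"
  have U: "distributed M lborel U std_normal_density" and V: "distributed M lborel V std_normal_density"
    unfolding U_def V_def
    using indep_vars_subset[OF indep I(4)] indep_vars_subset[OF indep J(4)] I J
    by (intro distributed_normalized_sum dens; fastforce)+
  have "I \<inter> J = {}" by (auto simp: I_def J_def)
  have sum_meas: "(\<lambda>x. (\<Sum>i\<in>K. x i) / c) \<in> borel_measurable (PiM K (\<lambda>_. borel))" for K :: "nat set" and c :: real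
    by (intro borel_measurable_divide borel_measurable_sum measurable_component_singleton) auto
  have "indep_var borel ((\<lambda>x. (\<Sum>i\<in>I. x i) / sqrt (card I)) \<circ> (\<lambda>\<omega>. restrict (\<lambda>i. A i \<omega>) I))
      borel ((\<lambda>x. (\<Sum>i\<in>J. x i) / sqrt (card J)) \<circ> (\<lambda>\<omega>. restrict (\<lambda>i. A i \<omega>) J))"
    by (rule indep_var_compose[OF indep_var_restrict[OF indep \<open>I \<inter> J = {}\<close> I(4) J(4)]])
      (rule sum_meas)+
  then have ind: "indep_var borel U borel V" by (simp add: o_def U_def[abs_def] V_def[abs_def])
  have [measurable]: "U \<in> borel_measurable M" "V \<in> borel_measurable M"
    using U V by (auto simp: distributed_def)
  have "prob {\<omega> \<in> space M. odd (num_roots_unit_disc (difference_char_poly (2 * m) (\<lambda>i. A i \<omega>)))}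
      = prob {\<omega> \<in> space M. \<bar>U \<omega>\<bar> < t * \<bar>V \<omega>\<bar>}"
  proof (rule measure_eq_AE)
    have "AE \<omega> in M. \<forall>z. cmod z = 1 \<longrightarrow> poly (difference_char_poly (2 * m) (\<lambda>i. A i \<omega>)) z \<noteq> 0"
      by (rule AE_no_root_on_circle[where f = "\<lambda>_. std_normal_density"]) (use indep dens in auto)
    then show "AE \<omega> in M. (\<omega> \<in> {\<omega> \<in> space M. odd (num_roots_unit_disc (difference_char_poly (2 * m) (\<lambda>i. A i \<omega>)))})
      \<longleftrightarrow> (\<omega> \<in> {\<omega> \<in> space M. \<bar>U \<omega>\<bar> < t * \<bar>V \<omega>\<bar>})"
    proof eventually_elim
      case (elim \<omega>)
      have "\<bar>\<Sum>i\<in>I. A i \<omega>\<bar> < \<bar>\<Sum>i\<in>J. A i \<omega>\<bar> \<longleftrightarrow> \<bar>U \<omega>\<bar> < t * \<bar>V \<omega>\<bar>"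
      proof -
        have t: "t = sqrt (real m) / sqrt (real (card I))"
          unfolding t_def I(2) by (simp add: real_sqrt_divide add.commute)
        have "t * \<bar>V \<omega>\<bar> = \<bar>\<Sum>i\<in>J. A i \<omega>\<bar> / sqrt (real (card I))"
          unfolding t V_def J(2) using m by (simp add: abs_divide)
        moreover have "\<bar>U \<omega>\<bar> = \<bar>\<Sum>i\<in>I. A i \<omega>\<bar> / sqrt (real (card I))"
          by (simp add: U_def abs_divide)
        moreover have "sqrt (real (card I)) > 0" unfolding I(2) by simp
        ultimately show ?thesis by (simp only: divide_less_cancel) auto
      qed
      then show ?case
        using odd_num_roots_unit_disc_iff[of "2 * m" "\<lambda>i. A i \<omega>"] elim by (simp add: I_def J_def)
    qed
    have "(\<lambda>\<omega>. num_roots_unit_disc (difference_char_poly (2 * m) (\<lambda>i. A i \<omega>))) \<in> measurable M (count_space UNIV)"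
      by (rule measurable_num_roots_unit_disc) (rule rv)
    then show "{\<omega> \<in> space M. odd (num_roots_unit_disc (difference_char_poly (2 * m) (\<lambda>i. A i \<omega>)))} \<in> events"
      by measurable
    show "{\<omega> \<in> space M. \<bar>U \<omega>\<bar> < t * \<bar>V \<omega>\<bar>} \<in> events" by measurable
  qed
  also have "\<dots> = 2 / pi * arctan t"
    by (rule prob_abs_normal_less[OF ind U V]) (simp add: t_def)
  finally show ?thesis by (simp add: t_def)
qed

section \<open>Sums invariant under reflection of the index\<close>

text \<open>The indices above the middle are paired with those below. Writing
  \<open>2 * i < n\<close> and \<open>2 * i = n\<close> treats both parities of \<open>n\<close> at
  once; for odd \<open>n\<close> there is no middle term.\<close>

lemma sum_symmetric:
  fixes p :: "nat \<Rightarrow> real"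
  assumes p: "\<And>i. i \<le> n \<Longrightarrow> p i = p (n - i)" and P: "\<And>i. i \<le> n \<Longrightarrow> P i \<longleftrightarrow> P (n - i)"
  shows "(\<Sum>i | i \<le> n \<and> P i. p i) = 2 * (\<Sum>i | 2 * i < n \<and> P i. p i) + (\<Sum>i | 2 * i = n \<and> P i. p i)"
proof -
  define L E G where "L = {i. 2 * i < n \<and> P i}" and "E = {i. 2 * i = n \<and> P i}"
    and "G = {i. i \<le> n \<and> n < 2 * i \<and> P i}"
  have fin: "finite L" "finite E" "finite G"
    by (auto simp: L_def E_def G_def intro: finite_subset[of _ "{..n}"])
  have "{i. i \<le> n \<and> P i} = L \<union> (G \<union> E)" by (auto simp: L_def E_def G_def)
  then have "(\<Sum>i | i \<le> n \<and> P i. p i) = sum p (L \<union> (G \<union> E))" by (rule arg_cong)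
  also have "\<dots> = sum p L + sum p (G \<union> E)"
    by (rule sum.union_disjoint) (use fin in \<open>auto simp: L_def E_def G_def\<close>)
  also have "sum p (G \<union> E) = sum p G + sum p E"
    by (rule sum.union_disjoint) (use fin in \<open>auto simp: E_def G_def\<close>)
  also have "sum p G = sum p L"
  proof (rule sum.reindex_bij_witness[of _ "\<lambda>i. n - i" "\<lambda>i. n - i"])
    fix i assume "i \<in> G"
    then have i: "i \<le> n" "n < 2 * i" "P i" by (auto simp: G_def)
    show "n - (n - i) = i" using i by simp
    show "n - i \<in> L" using i P[OF i(1)] by (auto simp: L_def)
    show "p (n - i) = p i" using p[OF i(1)] by simp
  next
    fix i assume "i \<in> L"
    then have i: "i \<le> n" "2 * i < n" "P i" by (auto simp: L_def)
    show "n - (n - i) = i" using i by simp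
    show "n - i \<in> G" using i P[OF i(1)] by (auto simp: G_def)
  qed
  finally show ?thesis by (simp add: L_def E_def)
qed

section \<open>The distribution of the number of roots\<close>

lemma (in prob_space) sum_prob_eq:
  fixes X :: "'a \<Rightarrow> nat"
  assumes X: "X \<in> measurable M (count_space UNIV)" and I: "finite I"
  shows "(\<Sum>i\<in>I. prob {\<omega> \<in> space M. X \<omega> = i}) = prob {\<omega> \<in> space M. X \<omega> \<in> I}"
proof -
  have "prob (\<Union>i\<in>I. {\<omega> \<in> space M. X \<omega> = i}) = (\<Sum>i\<in>I. prob {\<omega> \<in> space M. X \<omega> = i})"
    using X I by (intro finite_measure_finite_Union) (auto simp: disjoint_family_on_def)
  moreover have "(\<Union>i\<in>I. {\<omega> \<in> space M. X \<omega> = i}) = {\<omega> \<in> space M. X \<omega> \<in> I}" by auto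
  ultimately show ?thesis by simp
qed

lemma (in prob_space) expectation_bounded_nat:
  fixes X :: "'a \<Rightarrow> nat"
  assumes X: "X \<in> measurable M (count_space UNIV)" and le: "\<And>\<omega>. X \<omega> \<le> n"
  shows "(\<integral>\<omega>. real (X \<omega>) \<partial>M) = (\<Sum>i=0..n. real i * prob {\<omega> \<in> space M. X \<omega> = i})"
proof -
  have ev: "{\<omega> \<in> space M. X \<omega> = i} \<in> events" for i using X by measurable
  have "(\<integral>\<omega>. real (X \<omega>) \<partial>M) = (\<integral>\<omega>. (\<Sum>i=0..n. real i * indicator {\<omega> \<in> space M. X \<omega> = i} \<omega>) \<partial>M)"
  proof (rule Bochner_Integration.integral_cong[OF refl])
    fix \<omega> assume "\<omega> \<in> space M"
    then have "(\<Sum>i=0..n. real i * indicator {\<omega> \<in> space M. X \<omega> = i} \<omega>) =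
        (\<Sum>i=0..n. if i = X \<omega> then real i else 0)"
      by (intro sum.cong) (auto simp: indicator_def)
    then show "real (X \<omega>) = (\<Sum>i=0..n. real i * indicator {\<omega> \<in> space M. X \<omega> = i} \<omega>)"
      using le[of \<omega>] by simp
  qed
  also have "\<dots> = (\<Sum>i=0..n. real i * prob {\<omega> \<in> space M. X \<omega> = i})"
    using ev by (subst Bochner_Integration.integral_sum) (auto simp: less_top[symmetric])
  finally show ?thesis .
qed

text \<open>At \<open>n = 0\<close> the odd sum is empty, so the additional hypothesis of (c) and
  (d) fails there. Their ranges are written with \<open>i + 1\<close> and \<open>i + 2\<close> to
  avoid truncated subtraction. In (ii), \<open>m \<ge> 1\<close> keeps the denominator of
  \<open>(real m + 1) / real m\<close> non-zero.\<close>

theorem corollary13: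
  fixes M :: "'a measure" and A :: "nat \<Rightarrow> 'a \<Rightarrow> real" and n :: nat
    and X :: "'a \<Rightarrow> nat" and p :: "nat \<Rightarrow> real"
  assumes "prob_space M"
    and "prob_space.indep_vars M (\<lambda>_. borel) A {0..n}"
    and "\<And>i. i \<le> n \<Longrightarrow> distributed M lborel (A i) std_normal_density"
    and "X = (\<lambda>\<omega>. num_roots_unit_disc (difference_char_poly n (\<lambda>i. A i \<omega>)))"
    and "p = (\<lambda>i. measure M {\<omega> \<in> space M. X \<omega> = i})"
  shows
    "(\<integral>\<omega>. real (X \<omega>) \<partial>M) = (\<Sum>i=0..n. real i * p i) \<and> (\<Sum>i=0..n. real i * p i) = real n / 2
     \<and> (odd n \<longrightarrow> 2 * (\<Sum>i=0..(n - 1) div 2. p i) = 1)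
     \<and> (n = 1 \<longrightarrow> p 0 = 1/2 \<and> p 1 = 1/2)
     \<and> (even n \<and> n \<ge> 2 \<longrightarrow> 2 * (\<Sum>i=0..n div 2 - 1. p i) + p (n div 2) = 1)
     \<and> (even n \<and> (\<Sum>i | i \<le> n \<and> odd i. p i) = 1/2 \<and> (\<Sum>i | i \<le> n \<and> even i. p i) = 1/2 \<longrightarrow>
          (even (n div 2) \<longrightarrow>
             2 * (\<Sum>i | i + 2 \<le> n div 2 \<and> even i. p i) + p (n div 2) = 1/2
             \<and> 2 * (\<Sum>i | 1 \<le> i \<and> i + 1 \<le> n div 2 \<and> odd i. p i) = 1/2)
          \<and> (n = 4 \<longrightarrow> p 1 = 1/4 \<and> p 3 = 1/4 \<and> p 2 = 1/2 - 2 * p 0 \<and> p 4 = p 0)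
          \<and> (odd (n div 2) \<longrightarrow>
             2 * (\<Sum>i | i + 1 \<le> n div 2 \<and> even i. p i) = 1/2
             \<and> 2 * (\<Sum>i | 1 \<le> i \<and> i + 2 \<le> n div 2 \<and> odd i. p i) + p (n div 2) = 1/2)
          \<and> (n = 2 \<longrightarrow> p 0 = 1/4 \<and> p 2 = 1/4 \<and> p 1 = 1/2))
     \<and> (\<forall>m. m \<ge> 1 \<and> n = 2 * m \<longrightarrow>
          (\<Sum>i | i \<le> n \<and> even i. p i) = 2 / pi * arctan (sqrt ((real m + 1) / real m))
          \<and> (\<Sum>i | i \<le> n \<and> odd i. p i) = 2 / pi * arctan (sqrt (real m / (real m + 1))))
     \<and> (n = 2 \<longrightarrow> p 0 = 1 / pi * arctan (sqrt 2) \<and> p 2 = 1 / pi * arctan (sqrt 2)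
          \<and> p 1 = 2 / pi * arctan (1 / sqrt 2))
     \<and> (n = 4 \<longrightarrow> p 1 = 1 / pi * arctan (sqrt (2/3)) \<and> p 3 = 1 / pi * arctan (sqrt (2/3)))"
proof -
  interpret prob_space M by fact
  have indep: "indep_vars (\<lambda>_. borel) A {0..n}" by fact
  have dens: "distributed M lborel (A i) std_normal_density" if "i \<le> n" for i
    using assms(3) that .
  have rv: "random_variable borel (A i)" if "i \<le> n" for i
    using dens[OF that] by (auto simp: distributed_def)
  have X: "X \<in> measurable M (count_space UNIV)"
    unfolding assms(4) using rv by (rule measurable_num_roots_unit_disc)
  have X_le: "X \<omega> \<le> n" for \<omega>
    unfolding assms(4) by (meson num_roots_unit_disc_le degree_difference_char_poly_le order_trans)
  have sum_p: "(\<Sum>i | i \<le> n \<and> P i. p i) = prob {\<omega> \<in> space M. P (X \<omega>)}" for P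
    using sum_prob_eq[OF X, of "{i. i \<le> n \<and> P i}"] X_le by (simp add: assms(5))
  have sym: "p i = p (n - i)" if "i \<le> n" for i
    unfolding assms(5) assms(4) using indep dens that by (rule prob_num_roots_symmetric)
  have split: "(\<Sum>i | i \<le> n \<and> P i. p i) = 2 * (\<Sum>i | 2 * i < n \<and> P i. p i) + (\<Sum>i | 2 * i = n \<and> P i. p i)"
    if "\<And>i. i \<le> n \<Longrightarrow> P i \<longleftrightarrow> P (n - i)" for P
    using sym that by (rule sum_symmetric)
  have total: "(\<Sum>i\<le>n. p i) = 1"
    using sum_p[of "\<lambda>_. True"] prob_space by (simp add: atMost_def)
  have half: "2 * (\<Sum>i | 2 * i < n. p i) + (\<Sum>i | 2 * i = n. p i) = 1"
    using split[of "\<lambda>_. True"] total by (simp add: atMost_def)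
  \<comment> \<open>Evenness of \<open>n\<close> is what makes \<open>i \<mapsto> n - i\<close>
    preserve parity.\<close>
  have even_odd: "(\<Sum>i | i \<le> n \<and> even i. p i) = 2 * (\<Sum>i | 2 * i < n \<and> even i. p i) + (\<Sum>i | 2 * i = n \<and> even i. p i)"
    "(\<Sum>i | i \<le> n \<and> odd i. p i) = 2 * (\<Sum>i | 2 * i < n \<and> odd i. p i) + (\<Sum>i | 2 * i = n \<and> odd i. p i)"
    if "even n" using that by (auto intro!: split)
  have mean: "(\<integral>\<omega>. real (X \<omega>) \<partial>M) = (\<Sum>i=0..n. real i * p i)"
    unfolding assms(5) by (rule expectation_bounded_nat[OF X X_le])
  \<comment> \<open>Reflecting the index shows that the mean \<open>S\<close> satisfies
    \<open>S = n - S\<close>.\<close>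
  have mean_half: "(\<Sum>i=0..n. real i * p i) = real n / 2"
  proof -
    have "(\<Sum>i\<le>n. real i * p i) = (\<Sum>i\<le>n. real (n - i) * p (n - i))"
      by (rule sum.reindex_bij_witness[of _ "\<lambda>i. n - i" "\<lambda>i. n - i"]) auto
    also have "\<dots> = (\<Sum>i\<le>n. real n * p i - real i * p i)"
      by (intro sum.cong) (auto simp: of_nat_diff sym[symmetric] left_diff_distrib)
    also have "\<dots> = real n - (\<Sum>i\<le>n. real i * p i)"
      by (simp add: sum_subtractf total flip: sum_distrib_left)
    finally show ?thesis by (simp add: atLeast0AtMost)
  qed
  have n1: "{i. 2 * i < n} = {0..(n - 1) div 2}" "{i. 2 * i = n} = {}" if "odd n"
    using that by auto presburger+
  have a: "2 * (\<Sum>i=0..(n - 1) div 2. p i) = 1" if "odd n"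
    using half unfolding n1[OF that] by simp
  have a1: "p 0 = 1/2 \<and> p 1 = 1/2" if "n = 1"
    using a sym[of 0] that by simp
  have mid: "{i. 2 * i = n \<and> P i} = (if P (n div 2) then {n div 2} else {})" if "even n" for P
    using that by auto
  have b: "2 * (\<Sum>i=0..n div 2 - 1. p i) + p (n div 2) = 1" if "even n" "n \<ge> 2"
  proof -
    have "{i. 2 * i < n} = {0..n div 2 - 1}" using that by auto
    then show ?thesis using half mid[OF that(1), of "\<lambda>_. True"] by simp
  qed
  have set2: "{i. i \<le> n \<and> even i} = {0, 2}" "{i. i \<le> n \<and> odd i} = {1}" if "n = 2"
    using that by (simp_all add: set_eq_iff) presburger+
  have set4: "{i. i \<le> n \<and> even i} = {0, 2, 4}" "{i. i \<le> n \<and> odd i} = {1, 3}" if "n = 4"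
    using that by (simp_all add: set_eq_iff) presburger+
  have sym2: "p 0 = p 2" if "n = 2" using sym[of 0] that by simp
  have sym4: "p 0 = p 4" "p 1 = p 3" if "n = 4" using sym[of 0] sym[of 1] that by simp_all
  have cd: "(even (n div 2) \<longrightarrow>
             2 * (\<Sum>i | i + 2 \<le> n div 2 \<and> even i. p i) + p (n div 2) = 1/2
             \<and> 2 * (\<Sum>i | 1 \<le> i \<and> i + 1 \<le> n div 2 \<and> odd i. p i) = 1/2)
          \<and> (n = 4 \<longrightarrow> p 1 = 1/4 \<and> p 3 = 1/4 \<and> p 2 = 1/2 - 2 * p 0 \<and> p 4 = p 0)
          \<and> (odd (n div 2) \<longrightarrow>
             2 * (\<Sum>i | i + 1 \<le> n div 2 \<and> even i. p i) = 1/2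
             \<and> 2 * (\<Sum>i | 1 \<le> i \<and> i + 2 \<le> n div 2 \<and> odd i. p i) + p (n div 2) = 1/2)
          \<and> (n = 2 \<longrightarrow> p 0 = 1/4 \<and> p 2 = 1/4 \<and> p 1 = 1/2)"
    if n: "even n" and eq: "(\<Sum>i | i \<le> n \<and> odd i. p i) = 1/2" "(\<Sum>i | i \<le> n \<and> even i. p i) = 1/2"
  proof (intro conjI impI)
    assume h: "even (n div 2)"
    \<comment> \<open>The middle index \<open>n div 2\<close> is even here, so it enters the even
      sum only, and the largest even index below it is two less.\<close>
    have "{i. 2 * i < n \<and> even i} = {i. i + 2 \<le> n div 2 \<and> even i}" using n h by auto presburger
    then show "2 * (\<Sum>i | i + 2 \<le> n div 2 \<and> even i. p i) + p (n div 2) = 1/2"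
      using even_odd(1)[OF n] eq h by (simp add: mid[OF n])
    have "{i. 2 * i < n \<and> odd i} = {i. 1 \<le> i \<and> i + 1 \<le> n div 2 \<and> odd i}" using n h by (auto elim: oddE)
    then show "2 * (\<Sum>i | 1 \<le> i \<and> i + 1 \<le> n div 2 \<and> odd i. p i) = 1/2"
      using even_odd(2)[OF n] eq h by (simp add: mid[OF n])
  next
    assume h: "odd (n div 2)"
    have "{i. 2 * i < n \<and> even i} = {i. i + 1 \<le> n div 2 \<and> even i}" using n h by auto
    then show "2 * (\<Sum>i | i + 1 \<le> n div 2 \<and> even i. p i) = 1/2"
      using even_odd(1)[OF n] eq h by (simp add: mid[OF n])
    have "{i. 2 * i < n \<and> odd i} = {i. 1 \<le> i \<and> i + 2 \<le> n div 2 \<and> odd i}" using n h by auto presburger+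
    then show "2 * (\<Sum>i | 1 \<le> i \<and> i + 2 \<le> n div 2 \<and> odd i. p i) + p (n div 2) = 1/2"
      using even_odd(2)[OF n] eq h by (simp add: mid[OF n])
  qed (use eq set2 set4 sym2 sym4 in auto)
  have odd_sum: "(\<Sum>i | i \<le> n \<and> odd i. p i) = 2 / pi * arctan (sqrt (real m / (real m + 1)))"
    and even_sum: "(\<Sum>i | i \<le> n \<and> even i. p i) = 2 / pi * arctan (sqrt ((real m + 1) / real m))"
    if m: "m \<ge> 1" "n = 2 * m" for m
  proof -
    let ?t = "sqrt (real m / (real m + 1))"
    show o: "(\<Sum>i | i \<le> n \<and> odd i. p i) = 2 / pi * arctan ?t"
      unfolding sum_p[of odd] unfolding assms(4) m(2)
      by (rule prob_odd_num_roots) (use indep dens m in auto)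
    have "(\<Sum>i | i \<le> n \<and> even i. p i) + (\<Sum>i | i \<le> n \<and> odd i. p i) = (\<Sum>i\<le>n. p i)"
      by (subst sum.union_disjoint[symmetric]) (auto intro!: sum.cong)
    then have "(\<Sum>i | i \<le> n \<and> even i. p i) = 2 / pi * (pi / 2 - arctan ?t)"
      unfolding o total by (simp add: field_simps)
    also have "pi / 2 - arctan ?t = arctan (1 / ?t)"
    proof -
      have "?t > 0" using m by simp
      then show ?thesis using arctan_inverse[of ?t] by (simp only: inverse_eq_divide)
    qed
    also have "1 / ?t = sqrt ((real m + 1) / real m)"
      by (simp add: real_sqrt_divide)
    finally show "(\<Sum>i | i \<le> n \<and> even i. p i) = 2 / pi * arctan (sqrt ((real m + 1) / real m))" .
  qed
  have n2: "p 0 = 1 / pi * arctan (sqrt 2) \<and> p 2 = 1 / pi * arctan (sqrt 2)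
      \<and> p 1 = 2 / pi * arctan (1 / sqrt 2)" if n: "n = 2"
    using odd_sum[of 1] even_sum[of 1] n sym2[OF n] unfolding set2[OF n]
    by (simp add: real_sqrt_divide)
  have n4: "p 1 = 1 / pi * arctan (sqrt (2/3)) \<and> p 3 = 1 / pi * arctan (sqrt (2/3))" if n: "n = 4"
    using odd_sum[of 2] n sym4[OF n] unfolding set4[OF n] by simp
  show ?thesis
    using mean mean_half a a1 b cd even_sum odd_sum n2 n4 by blast
qed

end
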